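(* Let $f,g\colon I\to I$ be piecewise monotone, onto, strongly commuting maps. Then there is $x\in I$ such that $f(x)=g(x)=x$.
   Context: $I=[0,1]$; a map is a continuous function. A point $c\in(0,1)$ is a critical point of a map $f\colon I\to I$ if $f|_U$ is not one-to-one for every open interval $U\ni c$; $f$ is piecewise monotone if its set of critical points is finite. Maps $f,g$ strongly commute if $f\circ g^{-1}=g^{-1}\circ f$ as set-valued functions, i.e. for every $x\in I$, $\{f(y): y\in I,\ g(y)=x\}=\{z\in I: g(z)=f(x)\}$. *)

theory Defs
  imports "HOL-Analysis.Analysis"
begin

text \<open>
  A self-map of \<open>[0,1]\<close> is represented by a total function on the reals; all the notions below
  inspect its values on \<open>[0,1]\<close> only.
\<close>

abbreviation unit_interval :: "real set" where
  "unit_interval \<equiv> {0..1}"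

definition interval_map :: "(real \<Rightarrow> real) \<Rightarrow> bool" where
  "interval_map f \<longleftrightarrow> continuous_on unit_interval f \<and> f ` unit_interval \<subseteq> unit_interval"

text \<open>
  The open intervals range over those contained in the domain \<open>[0,1]\<close>. Larger ones would not
  change the notion, since failure of injectivity passes to larger intervals.
\<close>

definition critical_point :: "(real \<Rightarrow> real) \<Rightarrow> real \<Rightarrow> bool" where
  "critical_point f c \<longleftrightarrow> c \<in> {0<..<1} \<and>
     (\<forall>a b. {a<..<b} \<subseteq> unit_interval \<and> c \<in> {a<..<b} \<longrightarrow> \<not> inj_on f {a<..<b})"

definition piecewise_monotone :: "(real \<Rightarrow> real) \<Rightarrow> bool" where
  "piecewise_monotone f \<longleftrightarrow> finite {c. critical_point f c}"

definition strongly_commute :: "(real \<Rightarrow> real) \<Rightarrow> (real \<Rightarrow> real) \<Rightarrow> bool" where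
  "strongly_commute f g \<longleftrightarrow>
     (\<forall>x\<in>unit_interval. {f y | y. y \<in> unit_interval \<and> g y = x} = {z \<in> unit_interval. g z = f x})"

end

theory Submission
  imports Defs
begin

text \<open>
  Strong commutation says that \<open>y \<mapsto> (g y, f y)\<close> maps \<open>[0,1]\<close> onto \<open>{(x, z). f x = g z}\<close>. Hence this set
  is connected, so a local maximum of \<open>f\<close> and a local minimum of \<open>g\<close> never have the same value, and an
  extremum of \<open>g\<close> lifts along every preimage under \<open>f\<close> of its value at which \<open>f\<close> is not extremal.
  It follows that \<open>f\<close> permutes the finite set \<open>V\<close> of extremal values of \<open>g\<close> in \<open>]0,1[\<close>, and crosses
  each level \<open>v \<in> V\<close> only once. So \<open>f\<close> either fixes \<open>V\<close> pointwise and preserves the sides of its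
  points, or reverses the order of \<open>V\<close> and exchanges the sides; likewise for \<open>g\<close> and the extremal
  values \<open>W\<close> of \<open>f\<close>.

  If \<open>V\<close> and \<open>W\<close> are both nonempty and fixed, then there is a common point of \<open>V\<close> and \<open>W\<close>, or between
  a point of \<open>V\<close> and a point of \<open>W\<close> one of the maps has a single increasing inverse branch, and
  an extremal fixed point of the other map between them is a common fixed point. If only \<open>V\<close> is
  nonempty, then \<open>f\<close> is injective. If \<open>f\<close> reverses \<open>V\<close>, then its fixed points
  lie in the middle gap of \<open>V\<close>. There \<open>f\<close> has a unique fixed point, or \<open>g\<close> has a single inverse
  branch, or both maps preserve the gap and have no extremal values inside it. In this last case,
  which for the gap \<open>[0,1]\<close> is also the case \<open>V = W = {}\<close>, the middle inverse branches of \<open>f\<close> and \<open>g\<close>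
  commute, and commuting monotone maps have a common fixed point.
\<close>

section \<open>Intermediate values, extrema and levels on an interval\<close>

lemma ivt_between:
  fixes h :: "real \<Rightarrow> real"
  assumes "x \<le> y" "continuous_on {x..y} h" "h x \<le> u \<and> u \<le> h y \<or> h y \<le> u \<and> u \<le> h x"
  shows "\<exists>z\<in>{x..y}. h z = u"
  using assms(3)
proof
  assume "h x \<le> u \<and> u \<le> h y"
  with assms(1,2) IVT'[of h x u y] show ?thesis by (metis atLeastAtMost_iff)
next
  assume "h y \<le> u \<and> u \<le> h x"
  with assms(1,2) IVT2'[of h y u x] show ?thesis by (metis atLeastAtMost_iff)
qed

text \<open>A substitute for Rolle's theorem. If both the maximum and the minimum over
  \<open>{x..y}\<close> sit at end points, then \<open>h\<close> is constant there and the midpoint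
  serves.\<close>

lemma interior_extremum:
  fixes h :: "real \<Rightarrow> real"
  assumes "x < y" "continuous_on {x..y} h" "h x = h y"
  obtains s c where "s \<in> {1,-1::real}" "c \<in> {x<..<y}" "\<And>z. z \<in> {x..y} \<Longrightarrow> s * h z \<le> s * h c"
proof -
  obtain c where c: "c \<in> {x..y}" "\<And>z. z \<in> {x..y} \<Longrightarrow> h z \<le> h c"
    using continuous_attains_sup[of "{x..y}" h] assms by (metis atLeastAtMost_iff compact_Icc empty_iff less_imp_le order_refl)
  obtain d where d: "d \<in> {x..y}" "\<And>z. z \<in> {x..y} \<Longrightarrow> h d \<le> h z"
    using continuous_attains_inf[of "{x..y}" h] assms by (metis atLeastAtMost_iff compact_Icc empty_iff less_imp_le order_refl)
  show ?thesis
  proof (cases "c \<in> {x<..<y}")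
    case True
    then show ?thesis using that[of 1 c] c by auto
  next
    case False
    then have hc: "h c = h x" using c assms by (auto simp: order.antisym not_less)
    show ?thesis
    proof (cases "d \<in> {x<..<y}")
      case True
      then show ?thesis using that[of "-1" d] d by auto
    next
      case False
      then have hd: "h d = h x" using d assms by (auto simp: order.antisym not_less)
      have eq: "h z = h x" if "z \<in> {x..y}" for z using c(2)[OF that] d(2)[OF that] hc hd by linarith
      have m: "(x+y)/2 \<in> {x<..<y}" using assms(1) by simp
      show ?thesis
      proof (rule that[OF _ m])
        show "(1::real) \<in> {1,-1}" by simp
        show "1 * h z \<le> 1 * h ((x+y)/2)" if "z \<in> {x..y}" for z
          using eq[OF that] eq[of "(x+y)/2"] m by (simp del: mult_1)
      qed
    qed
  qed
qed

text \<open>The set where \<open>s * h x \<le> s * w\<close> is closed in \<open>X\<close>, and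
  \<open>loc\<close> makes it open at its points of level \<open>w\<close>; connectedness leaves
  only the two extreme cases.\<close>

lemma level_dichotomy:
  fixes h :: "real \<Rightarrow> real"
  assumes "connected X" "continuous_on X h"
    and loc: "\<And>x. x \<in> X \<Longrightarrow> h x = w \<Longrightarrow> \<exists>e>0. \<forall>y\<in>X. \<bar>y - x\<bar> < e \<longrightarrow> s * h y \<le> s * w"
  shows "(\<forall>x\<in>X. s * h x \<le> s * w) \<or> (\<forall>x\<in>X. s * h x > s * w)"
proof (cases "s = 0")
  case True then show ?thesis by simp
next
  case False
  define A where "A = {x\<in>X. s * h x \<le> s * w}"
  have cs: "continuous_on X (\<lambda>x. s * h x)" using assms(2) by (intro continuous_intros)
  have "closedin (top_of_set X) A"
    using continuous_closedin_preimage[OF cs, of "{..s * w}"]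
    by (auto simp: A_def vimage_def Int_def conj_commute)
  moreover have "openin (top_of_set X) A"
    unfolding openin_euclidean_subtopology_iff
  proof (intro conjI ballI)
    show "A \<subseteq> X" by (auto simp: A_def)
    fix x assume x: "x \<in> A"
    show "\<exists>e>0. \<forall>x'\<in>X. dist x' x < e \<longrightarrow> x' \<in> A"
    proof (cases "h x = w")
      case True
      then obtain e where "e > 0" "\<forall>y\<in>X. \<bar>y - x\<bar> < e \<longrightarrow> s * h y \<le> s * w"
        using loc[of x] x by (auto simp: A_def)
      then show ?thesis by (intro exI[of _ e]) (auto simp: A_def dist_real_def)
    next
      case neq: False
      then have lt: "s * h x < s * w" using x False by (auto simp: A_def order.strict_iff_order)
      obtain e where "e > 0" "\<forall>x'\<in>X. dist x' x < e \<longrightarrow> dist (s * h x') (s * h x) < s * w - s * h x"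
        using cs[unfolded continuous_on_iff, rule_format, of x "s * w - s * h x"] x lt by (auto simp: A_def)
      then show ?thesis by (intro exI[of _ e]) (force simp: A_def dist_real_def)
    qed
  qed
  ultimately have "A = {} \<or> A = X"
    using assms(1) connected_clopen by blast
  then show ?thesis by (auto simp: A_def not_le)
qed

subsection \<open>Extrema and crossings\<close>

text \<open>The sign \<open>s\<close> distinguishes local maxima (\<open>s = 1\<close>) from local minima (\<open>s = -1\<close>).
  The neighbourhoods are relative to \<open>[0,1]\<close>, so the end points count as extrema whenever the
  fibres are finite.\<close>

definition loc_ext :: "real \<Rightarrow> (real \<Rightarrow> real) \<Rightarrow> real \<Rightarrow> bool" where
  "loc_ext s h c \<longleftrightarrow> c \<in> {0..1} \<and> (\<exists>e>0. \<forall>y\<in>{0..1}. \<bar>y - c\<bar> < e \<longrightarrow> s * h y \<le> s * h c)"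

definition crosses :: "real \<Rightarrow> (real \<Rightarrow> real) \<Rightarrow> real \<Rightarrow> bool" where
  "crosses s h c \<longleftrightarrow> c \<in> {0<..<1} \<and>
     (\<exists>e>0. \<forall>y\<in>{0..1}. \<bar>y - c\<bar> < e \<longrightarrow> y \<noteq> c \<longrightarrow> 0 < s * (h y - h c) * (y - c))"

definition ext_values :: "real \<Rightarrow> (real \<Rightarrow> real) \<Rightarrow> real set" where
  "ext_values s h = {h c | c. loc_ext s h c}"

text \<open>The values 0 and 1 are left out because a map onto [0,1] has them as global extrema in
  any case.\<close>

definition turning_values :: "(real \<Rightarrow> real) \<Rightarrow> real set" where
  "turning_values h = {w \<in> {0<..<1}. w \<in> ext_values 1 h \<or> w \<in> ext_values (-1) h}"

lemma loc_extI:
  assumes "c \<in> {0..1}" "x < c" "c < y" "\<And>z. z \<in> {0..1} \<Longrightarrow> x < z \<Longrightarrow> z < y \<Longrightarrow> s * h z \<le> s * h c"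
  shows "loc_ext s h c"
  unfolding loc_ext_def
proof (intro conjI exI[of _ "min (c - x) (y - c)"] assms(1))
  show "0 < min (c - x) (y - c)" using assms by auto
  show "\<forall>z\<in>{0..1}. \<bar>z - c\<bar> < min (c - x) (y - c) \<longrightarrow> s * h z \<le> s * h c"
  proof (intro ballI impI)
    fix z :: real assume "z \<in> {0..1}" "\<bar>z - c\<bar> < min (c - x) (y - c)"
    then show "s * h z \<le> s * h c" by (intro assms(4)) auto
  qed
qed

text \<open>A continuous injection on an interval is strictly monotone, so near \<open>c\<close> it
  takes values on both sides of \<open>h c\<close>.\<close>

lemma loc_ext_imp_critical_point:
  assumes "continuous_on {0..1} h" "loc_ext s h c" "c \<in> {0<..<1}" "s \<in> {1,-1}"
  shows "critical_point h c"
  unfolding critical_point_def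
proof (intro conjI allI impI notI)
  show "c \<in> {0<..<1}" by fact
  fix a b assume ab: "{a<..<b} \<subseteq> {0..1} \<and> c \<in> {a<..<b}" and inj: "inj_on h {a<..<b}"
  obtain e where e: "e > 0" "\<And>y. y \<in> {0..1} \<Longrightarrow> \<bar>y - c\<bar> < e \<Longrightarrow> s * h y \<le> s * h c"
    using assms(2) by (auto simp: loc_ext_def)
  define x where "x = max ((a + c) / 2) (c - e/2)"
  define y where "y = min ((b + c) / 2) (c + e/2)"
  have "a < c" "c < b" using ab by auto
  then have xy: "a < x" "x < c" "c < y" "y < b" "\<bar>x - c\<bar> < e" "\<bar>y - c\<bar> < e"
    unfolding x_def y_def using e(1) by (simp_all add: max_def min_def abs_if field_simps)
  have sub: "{x..y} \<subseteq> {a<..<b}" using xy by auto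
  then have "{x..y} \<subseteq> {0..1}" using ab by blast
  moreover from this have "x \<in> {0..1}" "y \<in> {0..1}" by (rule subsetD, use xy in simp)+
  ultimately have I: "x \<in> {0..1}" "y \<in> {0..1}" "{x..y} \<subseteq> {0..1}" by blast+
  have "continuous_on {x..y} h" "inj_on h {x..y}"
    using continuous_on_subset[OF assms(1) I(3)] inj_on_subset[OF inj sub] by blast+
  from continuous_inj_imp_mono[OF xy(2,3) this]
  have "h x < h c \<and> h c < h y \<or> h y < h c \<and> h c < h x" by auto
  with e(2)[OF I(1) xy(5)] e(2)[OF I(2) xy(6)] assms(4) show False by auto
qed

text \<open>Between two points of a fibre there is an interior extremum, hence a critical point. So
  the number of critical points to the left, which is bounded, separates the points of the
  fibre.\<close>

lemma piecewise_monotone_finite_fibre: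
  assumes "continuous_on {0..1} h" "piecewise_monotone h"
  shows "finite {x\<in>{0..1}. h x = u}"
proof -
  let ?C = "{c. critical_point h c}"
  let ?S = "{x\<in>{0..1}. h x = u}"
  have fin: "finite ?C" using assms(2) by (simp add: piecewise_monotone_def)
  let ?r = "\<lambda>x. card {c\<in>?C. c < x}"
  have lt: "?r x < ?r y" if xy: "x \<in> ?S" "y \<in> ?S" "x < y" for x y
  proof -
    have sub: "{x..y} \<subseteq> {0..1}" using xy by auto
    obtain s c where sc: "s \<in> {1,-1::real}" "c \<in> {x<..<y}" "\<And>z. z \<in> {x..y} \<Longrightarrow> s * h z \<le> s * h c"
      using interior_extremum[of x y h] xy continuous_on_subset[OF assms(1) sub] by auto
    have "loc_ext s h c" using sc sub by (intro loc_extI[of c x y]) auto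
    then have "critical_point h c"
      using loc_ext_imp_critical_point[OF assms(1)] sc sub xy by auto
    then have "c \<in> {c\<in>?C. c < y} - {c\<in>?C. c < x}" using sc(2) by auto
    moreover have "{c\<in>?C. c < x} \<subseteq> {c\<in>?C. c < y}" using xy(3) by auto
    ultimately have "{c\<in>?C. c < x} \<subset> {c\<in>?C. c < y}" by blast
    then show ?thesis using fin by (intro psubset_card_mono) auto
  qed
  have "inj_on ?r ?S"
  proof (rule inj_onI)
    fix x y assume "x \<in> ?S" "y \<in> ?S" "?r x = ?r y"
    then show "x = y" using lt[of x y] lt[of y x] by linarith
  qed
  moreover have "?r ` ?S \<subseteq> {..card ?C}" using fin by (auto intro: card_mono)
  ultimately show ?thesis using finite_imageD finite_subset by blast
qed

lemma finite_turning_values: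
  assumes "continuous_on {0..1} h" "piecewise_monotone h"
  shows "finite (turning_values h)"
proof -
  \<comment> \<open>An extremum at an end point need not be a critical point, hence the two extra
    arguments.\<close>
  have "turning_values h \<subseteq> h ` ({c. critical_point h c} \<union> {0,1})"
  proof
    fix w assume "w \<in> turning_values h"
    then obtain s c where sc: "s \<in> {1,-1}" "loc_ext s h c" "w = h c"
      by (auto simp: turning_values_def ext_values_def)
    have "c \<in> {0<..<1} \<or> c \<in> {0,1}" using sc(2) by (auto simp: loc_ext_def)
    then show "w \<in> h ` ({c. critical_point h c} \<union> {0,1})"
      using loc_ext_imp_critical_point[OF assms(1) sc(2)] sc by blast
  qed
  then show ?thesis using assms(2) by (auto simp: piecewise_monotone_def intro: finite_subset)
qed

lemma isolated_in_finite:
  fixes S :: "real set"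
  assumes "finite S"
  obtains e where "e > 0" "\<And>y. y \<in> S \<Longrightarrow> \<bar>y - x\<bar> < e \<Longrightarrow> y = x"
proof -
  obtain e where "e > 0" "\<forall>y\<in>S. y \<noteq> x \<longrightarrow> e \<le> dist x y"
    using finite_set_avoid[OF assms, of x] by blast
  then show ?thesis using that[of e] by (force simp: dist_real_def abs_minus_commute)
qed

lemma constant_sign:
  fixes h :: "real \<Rightarrow> real"
  assumes "connected X" "continuous_on X h" "\<And>x. x \<in> X \<Longrightarrow> h x \<noteq> u"
  obtains s where "s \<in> {1,-1::real}" "\<And>x. x \<in> X \<Longrightarrow> 0 < s * (h x - u)"
proof -
  have "(\<forall>x\<in>X. 1 * h x \<le> 1 * u) \<or> (\<forall>x\<in>X. 1 * h x > 1 * u)"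
    by (rule level_dichotomy) (use assms in auto)
  then show ?thesis
  proof
    assume "\<forall>x\<in>X. 1 * h x \<le> 1 * u"
    then show ?thesis using that[of "-1"] assms(3) by force
  next
    assume "\<forall>x\<in>X. 1 * h x > 1 * u"
    then show ?thesis using that[of 1] by force
  qed
qed

text \<open>Finiteness isolates \<open>x\<close> in its fibre, so \<open>h y - h x\<close> has a
  constant sign on either side of \<open>x\<close>. Equal signs mean an extremum, opposite signs a
  crossing.\<close>

lemma loc_ext_or_crosses:
  assumes cont: "continuous_on {0..1} h" and fin: "finite {y\<in>{0..1}. h y = h x}" and x: "x \<in> {0..1}"
  obtains s where "s \<in> {1,-1}" "loc_ext s h x"
  | s where "s \<in> {1,-1}" "crosses s h x"
proof -
  obtain e where e: "e > 0" "\<And>y. y \<in> {0..1} \<Longrightarrow> h y = h x \<Longrightarrow> \<bar>y - x\<bar> < e \<Longrightarrow> y = x"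
    by (rule isolated_in_finite[OF fin, of x]) simp
  define L where "L = {max 0 (x - e/2)..<x}"
  define R where "R = {x<..min 1 (x + e/2)}"
  have LR: "connected L" "connected R" "L \<subseteq> {0..1}" "R \<subseteq> {0..1}"
    using x by (auto simp: L_def R_def)
  have "h y \<noteq> h x" if "y \<in> L \<union> R" for y
    using e(1) e(2)[of y] that LR by (auto simp: L_def R_def)
  then have ne: "\<And>y. y \<in> L \<Longrightarrow> h y \<noteq> h x" "\<And>y. y \<in> R \<Longrightarrow> h y \<noteq> h x" by auto
  obtain s where s: "s \<in> {1,-1::real}" "\<And>y. y \<in> R \<Longrightarrow> 0 < s * (h y - h x)"
    using constant_sign[OF LR(2) continuous_on_subset[OF cont LR(4)] ne(2)] by blast
  obtain t where t: "t \<in> {1,-1::real}" "\<And>y. y \<in> L \<Longrightarrow> 0 < t * (h y - h x)"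
    using constant_sign[OF LR(1) continuous_on_subset[OF cont LR(3)] ne(1)] by blast
  have ext: "loc_ext (-r) h x" if r: "\<And>y. y \<in> L \<union> R \<Longrightarrow> 0 < r * (h y - h x)" for r
    unfolding loc_ext_def
  proof (intro conjI x exI[of _ "e/2"] ballI impI)
    show "0 < e/2" using e by simp
    fix y :: real assume "y \<in> {0..1}" "\<bar>y - x\<bar> < e/2"
    then have "y \<in> L \<union> R \<or> y = x" unfolding L_def R_def by (auto simp: abs_if split: if_splits)
    then show "- r * h y \<le> - r * h x" using r[of y] by (auto simp: algebra_simps)
  qed
  show ?thesis
  \<comment> \<open>At an end point one of \<open>L\<close> and \<open>R\<close> is empty and
    imposes no sign.\<close>
  proof (cases "s = t \<or> x = 0 \<or> x = 1")
    case True
    then have "\<exists>r\<in>{1,-1}. \<forall>y\<in>L \<union> R. 0 < r * (h y - h x)"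
    proof (elim disjE)
      assume "x = 0" then have "L = {}" by (auto simp: L_def)
      then show ?thesis using s by auto
    next
      assume "x = 1" then have "R = {}" by (auto simp: R_def)
      then show ?thesis using t by auto
    qed (use s t in auto)
    then obtain r where "r \<in> {1,-1::real}" "\<And>y. y \<in> L \<union> R \<Longrightarrow> 0 < r * (h y - h x)" by blast
    then show ?thesis using that(1)[of "-r"] ext[of r] by auto
  next
    case False
    then have st: "t = - s" using s t by auto
    have "crosses s h x"
      unfolding crosses_def
    proof (intro conjI exI[of _ "e/2"] ballI impI)
      show "x \<in> {0<..<1}" using False x by auto
      show "0 < e/2" using e by simp
      fix y :: real assume y: "y \<in> {0..1}" "\<bar>y - x\<bar> < e/2" "y \<noteq> x"
      then have "y \<in> L \<and> y < x \<or> y \<in> R \<and> x < y"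
        unfolding L_def R_def by (auto simp: abs_if split: if_splits)
      then show "0 < s * (h y - h x) * (y - x)"
      proof
        assume "y \<in> L \<and> y < x"
        then have "s * (h y - h x) < 0" "y - x < 0" using t(2)[of y] st by auto
        then show ?thesis by (rule mult_neg_neg)
      next
        assume "y \<in> R \<and> x < y"
        then show ?thesis using s(2)[of y] by auto
      qed
    qed
    then show ?thesis using that(2) s by blast
  qed
qed

lemma loc_ext_strict:
  assumes "finite {y\<in>{0..1}. h y = h x}" "loc_ext s h x"
  obtains e where "e > 0"
    "\<And>y. y \<in> {0..1} \<Longrightarrow> \<bar>y - x\<bar> < e \<Longrightarrow> s * h y \<le> s * h x"
    "\<And>y. y \<in> {0..1} \<Longrightarrow> \<bar>y - x\<bar> < e \<Longrightarrow> h y = h x \<Longrightarrow> y = x"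
proof -
  obtain d where d: "d > 0" "\<And>y. y \<in> {0..1} \<Longrightarrow> \<bar>y - x\<bar> < d \<Longrightarrow> s * h y \<le> s * h x"
    using assms(2) unfolding loc_ext_def by blast
  obtain e where e: "e > 0" "\<And>y. y \<in> {0..1} \<Longrightarrow> h y = h x \<Longrightarrow> \<bar>y - x\<bar> < e \<Longrightarrow> y = x"
    by (rule isolated_in_finite[OF assms(1), of x]) simp
  show ?thesis
    by (rule that[of "min d e"]) (use d e in auto)
qed

lemma continuous_on_real_near:
  fixes h :: "real \<Rightarrow> real"
  assumes "continuous_on A h" "x \<in> A" "e > 0"
  obtains d where "d > 0" "\<And>y. y \<in> A \<Longrightarrow> \<bar>y - x\<bar> < d \<Longrightarrow> \<bar>h y - h x\<bar> < e"
proof -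
  obtain d where "d > 0" "\<forall>y\<in>A. dist y x < d \<longrightarrow> dist (h y) (h x) < e"
    using assms unfolding continuous_on_iff by blast
  then show ?thesis using that[of d] by (simp add: dist_real_def)
qed

subsection \<open>Turning values of strongly commuting maps\<close>

text \<open>The two inclusions of strong commutation become \<open>comm\<close> and
  \<open>lift\<close>; piecewise monotonicity enters through the finiteness assumptions. This form
  is symmetric in \<open>f\<close> and \<open>g\<close>, so every result is also available with the
  roles exchanged.\<close>

locale strongly_commuting =
  fixes f g :: "real \<Rightarrow> real"
  assumes cont_f: "continuous_on {0..1} f" and cont_g: "continuous_on {0..1} g"
    and onto_f: "f ` {0..1} = {0..1}" and onto_g: "g ` {0..1} = {0..1}"
    and fin_f: "finite {x\<in>{0..1}. f x = u}" and fin_g: "finite {x\<in>{0..1}. g x = u}"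
    and fin_tf: "finite (turning_values f)" and fin_tg: "finite (turning_values g)"
    and comm: "x \<in> {0..1} \<Longrightarrow> f (g x) = g (f x)"
    and lift: "x \<in> {0..1} \<Longrightarrow> z \<in> {0..1} \<Longrightarrow> f x = g z \<Longrightarrow> \<exists>y\<in>{0..1}. g y = x \<and> f y = z"
begin

lemma swap: "strongly_commuting g f"
proof
  show "\<exists>y\<in>{0..1}. f y = x \<and> g y = z" if "x \<in> {0..1}" "z \<in> {0..1}" "g x = f z" for x z
    using lift[OF that(2,1) that(3)[symmetric]] by blast
qed (use cont_f cont_g onto_f onto_g fin_f fin_g fin_tf fin_tg comm in auto)

lemma f_in: "x \<in> {0..1} \<Longrightarrow> f x \<in> {0..1}" and g_in: "x \<in> {0..1} \<Longrightarrow> g x \<in> {0..1}"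
  using onto_f onto_g by blast+

text \<open>Such a pair \<open>(x, z)\<close> would be an isolated point of the connected set
  \<open>{(x, z). f x = g z}\<close>, which is the image of \<open>y \<mapsto> (g y, f y)\<close>.\<close>

lemma no_opposite_ext:
  assumes "f x = g z" "loc_ext s f x" "loc_ext (- s) g z" "s \<in> {1,-1}"
  shows False
proof -
  have xz: "x \<in> {0..1}" "z \<in> {0..1}" using assms by (auto simp: loc_ext_def)
  obtain e where e: "e > 0" "\<And>y. y \<in> {0..1} \<Longrightarrow> \<bar>y - x\<bar> < e \<Longrightarrow> s * f y \<le> s * f x"
    "\<And>y. y \<in> {0..1} \<Longrightarrow> \<bar>y - x\<bar> < e \<Longrightarrow> f y = f x \<Longrightarrow> y = x"
    using loc_ext_strict[OF fin_f assms(2)] by metis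
  obtain d where d: "d > 0" "\<And>y. y \<in> {0..1} \<Longrightarrow> \<bar>y - z\<bar> < d \<Longrightarrow> - s * g y \<le> - s * g z"
    "\<And>y. y \<in> {0..1} \<Longrightarrow> \<bar>y - z\<bar> < d \<Longrightarrow> g y = g z \<Longrightarrow> y = z"
    using loc_ext_strict[OF fin_g assms(3)] by metis
  \<comment> \<open>\<open>K\<close> collects the parameters that are mapped to
    \<open>(x, z)\<close>. Being clopen and nonempty, it would be all of [0,1], and \<open>g\<close>
    would be constant.\<close>
  define K where "K = {y\<in>{0..1}. g y = x} \<inter> {y\<in>{0..1}. f y = z}"
  have "closedin (top_of_set {0..1}) K"
    unfolding K_def
    by (intro closedin_Int continuous_closedin_preimage_constant cont_f cont_g)
  moreover have "openin (top_of_set {0..1}) K"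
    unfolding openin_euclidean_subtopology_iff
  proof (intro conjI ballI)
    show "K \<subseteq> {0..1}" by (auto simp: K_def)
    fix y assume y: "y \<in> K"
    then have yI: "y \<in> {0..1}" "g y = x" "f y = z" by (auto simp: K_def)
    obtain e' where e': "e' > 0" "\<And>y'. y' \<in> {0..1} \<Longrightarrow> \<bar>y' - y\<bar> < e' \<Longrightarrow> \<bar>g y' - x\<bar> < e"
      using continuous_on_real_near[OF cont_g yI(1) e(1)] yI by metis
    obtain d' where d': "d' > 0" "\<And>y'. y' \<in> {0..1} \<Longrightarrow> \<bar>y' - y\<bar> < d' \<Longrightarrow> \<bar>f y' - z\<bar> < d"
      using continuous_on_real_near[OF cont_f yI(1) d(1)] yI by metis
    show "\<exists>r>0. \<forall>y'\<in>{0..1}. dist y' y < r \<longrightarrow> y' \<in> K"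
    proof (intro exI[of _ "min e' d'"] conjI ballI impI)
      show "0 < min e' d'" using e' d' by simp
      fix y' :: real assume y': "y' \<in> {0..1}" "dist y' y < min e' d'"
      then have near: "\<bar>g y' - x\<bar> < e" "\<bar>f y' - z\<bar> < d" using e' d' by (auto simp: dist_real_def)
      \<comment> \<open>By commutation the chain
        \<open>s * f (g y') \<le> s * f x = s * g z \<le> s * g (f y')\<close> begins and ends with
        the same number.\<close>
      have "s * f (g y') \<le> s * f x" "- s * g (f y') \<le> - s * g z"
        using e(2)[OF g_in[OF y'(1)] near(1)] d(2)[OF f_in[OF y'(1)] near(2)] by auto
      then have "f (g y') = f x" "g (f y') = g z" using comm[OF y'(1)] assms(1,4) by auto
      then show "y' \<in> K"
        using e(3)[OF g_in[OF y'(1)] near(1)] d(3)[OF f_in[OF y'(1)] near(2)] y'(1) by (simp add: K_def)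
    qed
  qed
  ultimately have "K = {} \<or> K = {0..1}"
    using connected_clopen[of "{0..1::real}"] connected_Icc by blast
  moreover have "K \<noteq> {}" using lift[OF xz assms(1)] by (auto simp: K_def)
  ultimately have "g ` {0..1} \<subseteq> {x}" by (auto simp: K_def)
  then show False using onto_g by (metis atLeastAtMost_iff order_refl singletonD subsetD zero_le_one zero_neq_one)
qed

text \<open>Take \<open>y\<close> with \<open>g y = x\<close> and \<open>f y = c\<close>. Near
  \<open>y\<close> the extremum at \<open>c\<close> keeps \<open>g (f y') = f (g y')\<close> on one
  side of \<open>f x\<close>; as \<open>f\<close> crosses this level at \<open>x\<close>,
  \<open>g y'\<close> stays on one side of \<open>x\<close>.\<close>

lemma pull_back_ext:
  assumes "loc_ext s g c" "f x = g c" "crosses t f x" "s \<in> {1,-1}" "t \<in> {1,-1}"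
  shows "x \<in> ext_values (s * t) g"
proof -
  have xc: "x \<in> {0..1}" "c \<in> {0..1}" using assms by (auto simp: loc_ext_def crosses_def)
  obtain y where y: "y \<in> {0..1}" "g y = x" "f y = c" using lift[OF xc assms(2)] by blast
  obtain e where e: "e > 0" "\<And>y. y \<in> {0..1} \<Longrightarrow> \<bar>y - c\<bar> < e \<Longrightarrow> s * g y \<le> s * g c"
    using assms(1) unfolding loc_ext_def by blast
  obtain d where d: "d > 0"
    "\<And>y. y \<in> {0..1} \<Longrightarrow> \<bar>y - x\<bar> < d \<Longrightarrow> y \<noteq> x \<Longrightarrow> 0 < t * (f y - f x) * (y - x)"
    using assms(3) unfolding crosses_def by blast
  obtain e' where e': "e' > 0" "\<And>y'. y' \<in> {0..1} \<Longrightarrow> \<bar>y' - y\<bar> < e' \<Longrightarrow> \<bar>f y' - c\<bar> < e"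
    using continuous_on_real_near[OF cont_f y(1) e(1)] y by metis
  obtain d' where d': "d' > 0" "\<And>y'. y' \<in> {0..1} \<Longrightarrow> \<bar>y' - y\<bar> < d' \<Longrightarrow> \<bar>g y' - x\<bar> < d"
    using continuous_on_real_near[OF cont_g y(1) d(1)] y by metis
  have "loc_ext (s * t) g y"
    unfolding loc_ext_def
  proof (intro conjI y(1) exI[of _ "min e' d'"] ballI impI)
    show "0 < min e' d'" using e' d' by simp
    fix y' :: real assume y': "y' \<in> {0..1}" "\<bar>y' - y\<bar> < min e' d'"
    then have near: "\<bar>f y' - c\<bar> < e" "\<bar>g y' - x\<bar> < d" using e' d' by auto
    have 1: "s * f (g y') \<le> s * f x"
      using e(2)[OF f_in[OF y'(1)] near(1)] comm[OF y'(1)] assms(2) by simp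
    show "s * t * g y' \<le> s * t * g y"
    proof (cases "g y' = x")
      case False
      have 2: "0 < t * (f (g y') - f x) * (g y' - x)"
        by (rule d(2)[OF g_in[OF y'(1)] near(2) False])
      then show ?thesis using 1 assms(4,5) y(2) by (auto simp: zero_less_mult_iff mult_less_0_iff)
    qed (simp add: y)
  qed
  then show ?thesis using y(2) by (auto simp: ext_values_def)
qed

lemma turning_value_ext:
  assumes "w \<in> turning_values g"
  obtains s c where "s \<in> {1,-1}" "loc_ext s g c" "g c = w" "w \<in> {0<..<1}"
  using assms unfolding turning_values_def ext_values_def by blast

lemma crossing_preimage_turning:
  assumes "f x \<in> turning_values g" "crosses t f x" "t \<in> {1,-1}"
  shows "x \<in> turning_values g"
proof -
  obtain s c where sc: "s \<in> {1,-1}" "loc_ext s g c" "g c = f x"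
    using turning_value_ext[OF assms(1)] by metis
  have "x \<in> ext_values (s * t) g" by (rule pull_back_ext[OF sc(2) sc(3)[symmetric] assms(2) sc(1) assms(3)])
  moreover have "x \<in> {0<..<1}" using assms(2) by (simp add: crosses_def)
  ultimately show ?thesis using sc(1) assms(3) by (auto simp: turning_values_def)
qed

lemma preimage_ext_or_crosses:
  assumes "x \<in> {0..1}" "f x = g c" "loc_ext s g c" "s \<in> {1,-1}"
  shows "loc_ext s f x \<or> (\<exists>t\<in>{1,-1}. crosses t f x)"
proof (rule loc_ext_or_crosses[OF cont_f fin_f assms(1)])
  fix r assume r: "r \<in> {1,-1::real}" "loc_ext r f x"
  have "r \<noteq> - s" using no_opposite_ext[OF assms(2), of r] r assms(3,4) by auto
  then have "r = s" using r assms(4) by auto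
  then show ?thesis using r by simp
qed auto

text \<open>If every preimage of \<open>w\<close> were an extremum, all would have the sign
  \<open>s\<close> and \<open>f\<close> would stay on one side of \<open>w\<close>. This contradicts
  surjectivity, since \<open>w\<close> lies strictly between 0 and 1.\<close>

lemma ex_crossing_preimage:
  assumes w: "w \<in> turning_values g"
  shows "\<exists>x\<in>turning_values g. f x = w \<and> (\<exists>t\<in>{1,-1}. crosses t f x)"
proof -
  obtain s c where sc: "s \<in> {1,-1}" "loc_ext s g c" "g c = w" "w \<in> {0<..<1}"
    using turning_value_ext[OF w] by metis
  have "\<exists>x\<in>{0..1}. f x = w \<and> (\<exists>t\<in>{1,-1}. crosses t f x)"
  proof (rule ccontr)
    assume no: "\<not> ?thesis"
    have "(\<forall>x\<in>{0..1}. s * f x \<le> s * w) \<or> (\<forall>x\<in>{0..1}. s * f x > s * w)"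
    proof (rule level_dichotomy[OF _ cont_f])
      fix x assume x: "x \<in> {0..1::real}" "f x = w"
      then have "f x = g c" using sc(3) by simp
      from preimage_ext_or_crosses[OF x(1) this sc(2,1)] have "loc_ext s f x" using no x by blast
      then show "\<exists>e>0. \<forall>y\<in>{0..1}. \<bar>y - x\<bar> < e \<longrightarrow> s * f y \<le> s * w"
        using x by (simp add: loc_ext_def)
    qed simp
    moreover obtain a b where "a \<in> {0..1}" "f a = 0" "b \<in> {0..1}" "f b = 1"
      using onto_f by (metis (no_types, opaque_lifting) atLeastAtMost_iff imageE order_refl zero_le_one)
    ultimately show False using sc(1,4) by force
  qed
  then show ?thesis using crossing_preimage_turning w by blast
qed

text \<open>Choosing a crossing preimage gives an injection of the finite set of turning values into itself,
  hence a bijection; so every turning value of \<open>g\<close> is crossed by \<open>f\<close> exactly once.\<close>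

lemma turning_values_permuted:
  shows "f ` turning_values g = turning_values g" and "inj_on f (turning_values g)"
    and "v \<in> turning_values g \<Longrightarrow> \<exists>t\<in>{1,-1}. crosses t f v"
proof -
  let ?V = "turning_values g"
  obtain p where p: "\<And>w. w \<in> ?V \<Longrightarrow> p w \<in> ?V \<and> f (p w) = w \<and> (\<exists>t\<in>{1,-1}. crosses t f (p w))"
    using ex_crossing_preimage by metis
  have "inj_on p ?V" using p by (metis inj_onI)
  then have pV: "p ` ?V = ?V" using p by (intro endo_inj_surj fin_tg) auto
  show "f ` ?V = ?V"
  proof
    show "f ` ?V \<subseteq> ?V" using pV p by (metis (no_types, lifting) image_iff image_subsetI)
    show "?V \<subseteq> f ` ?V" using p by (metis image_eqI subsetI)
  qed
  then show "inj_on f ?V" using fin_tg by (simp add: eq_card_imp_inj_on)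
  show "\<exists>t\<in>{1,-1}. crosses t f v" if "v \<in> ?V" using that pV p by (metis imageE)
qed

text \<open>A second crossing preimage of \<open>f a\<close> would be a turning value of
  \<open>g\<close> as well, against injectivity of \<open>f\<close> on these.\<close>

lemma other_preimages_ext:
  assumes "a \<in> turning_values g" "f a = g c" "loc_ext s g c" "s \<in> {1,-1}"
    and "x \<in> {0..1}" "f x = f a" "x \<noteq> a"
  shows "loc_ext s f x"
proof -
  have "f a \<in> turning_values g" using assms(1) turning_values_permuted(1) by blast
  then have "\<not> crosses t f x" if "t \<in> {1,-1}" for t
    using crossing_preimage_turning[of x t] that assms turning_values_permuted(2) by (metis inj_onD)
  then show ?thesis using preimage_ext_or_crosses[of x c s] assms by metis
qed

text \<open>Any further preimage is an extremum of \<open>f\<close> and makes \<open>v\<close> a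
  turning value of \<open>f\<close>. Single inverse branches over whole intervals are derived from
  this one point.\<close>

lemma single_preimage_turning:
  assumes "v \<in> turning_values g" "v \<notin> turning_values f"
    and xy: "x \<in> {0..1}" "y \<in> {0..1}" "f x = v" "f y = v"
  shows "x = y"
proof -
  obtain a where a: "a \<in> turning_values g" "f a = v" using assms turning_values_permuted(1) by (metis imageE)
  obtain s c where sc: "s \<in> {1,-1}" "loc_ext s g c" "g c = v" "v \<in> {0<..<1}"
    using turning_value_ext[OF assms(1)] by metis
  have "z = a" if "z \<in> {0..1}" "f z = v" for z
  proof (rule ccontr)
    assume "z \<noteq> a"
    then have "loc_ext s f z" using other_preimages_ext[OF a(1)] sc a that by auto
    then have "v \<in> turning_values f" using sc that by (auto simp: turning_values_def ext_values_def)
    then show False using assms by simp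
  qed
  then show ?thesis using xy by blast
qed

text \<open>On each side of \<open>a\<close> all preimages of \<open>f a\<close> are extrema of the
  same sign, so \<open>level_dichotomy\<close> keeps \<open>f\<close> on one side of
  \<open>f a\<close>. The crossing at \<open>a\<close> decides which, with opposite outcomes to the
  left and to the right.\<close>

lemma turning_values_sides:
  assumes a: "a \<in> turning_values g"
  shows "\<exists>t\<in>{1,-1}. \<forall>x\<in>{0..1}. 0 \<le> t * (f x - f a) * (x - a)"
proof -
  have "f a \<in> turning_values g" using a turning_values_permuted(1) by blast
  then obtain s c where sc: "s \<in> {1,-1}" "loc_ext s g c" "g c = f a"
    using turning_value_ext by metis
  obtain t where t: "t \<in> {1,-1}" "crosses t f a" using turning_values_permuted(3)[OF a] by blast
  obtain e where e: "e > 0" "\<And>y. y \<in> {0..1} \<Longrightarrow> \<bar>y - a\<bar> < e \<Longrightarrow> y \<noteq> a \<Longrightarrow> 0 < t * (f y - f a) * (y - a)"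
    and aI: "a \<in> {0<..<1}"
    using t(2) unfolding crosses_def by blast
  \<comment> \<open>\<open>X\<close> is going to be one of the two sides of \<open>a\<close>,
    \<open>r\<close> the sign of \<open>x - a\<close> on it, and \<open>y\<close> a point so near to
    \<open>a\<close> that the crossing determines the sign of \<open>f y - f a\<close>.\<close>
  have side: "\<forall>x\<in>X. 0 \<le> t * (f x - f a) * (x - a)"
    if X: "X \<subseteq> {0..1}" "connected X" "r \<in> {1,-1}" "\<And>x. x \<in> X \<Longrightarrow> 0 < r * (x - a)"
      and y: "y \<in> X" "\<bar>y - a\<bar> < e" for X r y
  proof -
    have dich: "(\<forall>x\<in>X. s * f x \<le> s * f a) \<or> (\<forall>x\<in>X. s * f x > s * f a)"
    proof (rule level_dichotomy[OF X(2) continuous_on_subset[OF cont_f X(1)]])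
      fix x assume x: "x \<in> X" "f x = f a"
      then have "loc_ext s f x"
        using other_preimages_ext[OF a sc(3)[symmetric] sc(2,1), of x] X by fastforce
      then show "\<exists>e>0. \<forall>y\<in>X. \<bar>y - x\<bar> < e \<longrightarrow> s * f y \<le> s * f a"
        using x X(1) unfolding loc_ext_def by (metis subsetD)
    qed
    have ny: "0 < t * (f y - f a) * (y - a)"
      using e(2)[of y] X y by force
    have "0 < t * r * (f y - f a)"
      using ny X(3) X(4)[OF y(1)] by (auto simp: zero_less_mult_iff mult_less_0_iff)
    consider "r * t = s" | "r * t = - s" using sc(1) X(3) t(1) by auto
    then have *: "\<forall>x\<in>X. 0 \<le> r * t * (f x - f a)"
    proof cases
      case 1
      then have "s * f y > s * f a" using \<open>0 < t * r * (f y - f a)\<close> by (simp add: algebra_simps)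
      then have "\<forall>x\<in>X. s * f x > s * f a" using dich y(1) by (meson not_less)
      then show ?thesis using 1 by (simp add: right_diff_distrib less_imp_le)
    next
      case 2
      then have "s * f y < s * f a" using \<open>0 < t * r * (f y - f a)\<close> by (simp add: algebra_simps)
      then have "\<forall>x\<in>X. s * f x \<le> s * f a" using dich y(1) by (meson less_asym)
      then show ?thesis using 2 by (simp add: right_diff_distrib)
    qed
    show ?thesis
    proof
      fix x assume x: "x \<in> X"
      have "0 \<le> (r * t * (f x - f a)) * (r * (x - a))"
        by (rule mult_nonneg_nonneg) (use * X(4) x in \<open>auto intro: less_imp_le\<close>)
      also have "\<dots> = r * r * (t * (f x - f a) * (x - a))" by (simp add: algebra_simps)
      also have "r * r = 1" using X(3) by auto
      finally show "0 \<le> t * (f x - f a) * (x - a)" by simp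
    qed
  qed
  have "\<forall>x\<in>{0..<a}. 0 \<le> t * (f x - f a) * (x - a)"
    by (rule side[of _ "-1" "max 0 (a - e/2)"]) (use aI e(1) in auto)
  moreover have "\<forall>x\<in>{a<..1}. 0 \<le> t * (f x - f a) * (x - a)"
    by (rule side[of _ "1" "min 1 (a + e/2)"]) (use aI e(1) in auto)
  ultimately have "\<forall>x\<in>{0..1}. 0 \<le> t * (f x - f a) * (x - a)"
    by (metis atLeastAtMost_iff atLeastLessThan_iff diff_self greaterThanAtMost_iff linorder_neqE mult_zero_right order_refl)
  then show ?thesis using t by blast
qed

text \<open>Opposite orientations at \<open>a\<close> and \<open>b\<close> give
  \<open>f 1 \<le> f a \<le> f 0 \<le> f b \<le> f 1\<close>, so \<open>f a = f b\<close> and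
  \<open>a = b\<close>. Then \<open>f\<close> is constant, against finiteness of its fibres.\<close>

lemma turning_values_orientation:
  "\<exists>t\<in>{1,-1}. \<forall>a\<in>turning_values g. \<forall>x\<in>{0..1}. 0 \<le> t * (f x - f a) * (x - a)"
proof (rule ccontr)
  let ?P = "\<lambda>t a. \<forall>x\<in>{0..1}. 0 \<le> t * (f x - f a) * (x - a)"
  assume no: "\<not> ?thesis"
  then obtain a where a: "a \<in> turning_values g" "\<not> ?P 1 a" by blast
  then have a1: "?P (-1) a" using turning_values_sides[OF a(1)] by blast
  from no obtain b where b: "b \<in> turning_values g" "\<not> ?P (-1) b" by blast
  then have b1: "?P 1 b" using turning_values_sides[OF b(1)] by blast
  have ab: "a \<in> {0<..<1}" "b \<in> {0<..<1}" using a b by (auto simp: turning_values_def)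
  have "f 1 \<le> f a" "f a \<le> f 0"
    using a1[rule_format, of 1] a1[rule_format, of 0] ab by (auto simp: mult_le_0_iff zero_le_mult_iff)
  moreover have "f 0 \<le> f b" "f b \<le> f 1"
    using b1[rule_format, of 1] b1[rule_format, of 0] ab by (auto simp: mult_le_0_iff zero_le_mult_iff)
  ultimately have "f a = f b" by linarith
  then have "a = b" using turning_values_permuted(2) a b by (metis inj_onD)
  then have "f x = f a" if "x \<in> {0..1}" for x
    using a1[rule_format, OF that] b1[rule_format, OF that] by (cases "x = a") (auto simp: zero_le_mult_iff mult_le_0_iff)
  then have "{x\<in>{0..1}. f x = f a} = {0..1}" by auto
  then show False using fin_f[of "f a"] infinite_Icc[of 0 "1::real"] by simp
qed

text \<open>With positive orientation \<open>f\<close> is an increasing permutation of the finite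
  set \<open>?V\<close>, hence the identity on it.\<close>

lemma turning_values_structure:
  obtains (fixing) "\<And>v. v \<in> turning_values g \<Longrightarrow> f v = v"
      "\<And>v x. v \<in> turning_values g \<Longrightarrow> x \<in> {0..1} \<Longrightarrow> x < v \<Longrightarrow> f x \<le> v"
      "\<And>v x. v \<in> turning_values g \<Longrightarrow> x \<in> {0..1} \<Longrightarrow> v < x \<Longrightarrow> v \<le> f x"
  | (reversing) "\<And>v x. v \<in> turning_values g \<Longrightarrow> x \<in> {0..1} \<Longrightarrow> x < v \<Longrightarrow> f v \<le> f x"
      "\<And>v x. v \<in> turning_values g \<Longrightarrow> x \<in> {0..1} \<Longrightarrow> v < x \<Longrightarrow> f x \<le> f v"
proof -
  let ?V = "turning_values g"
  obtain t where t: "t \<in> {1,-1}" "\<And>v x. v \<in> ?V \<Longrightarrow> x \<in> {0..1} \<Longrightarrow> 0 \<le> t * (f x - f v) * (x - v)"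
    using turning_values_orientation by blast
  have VI: "?V \<subseteq> {0..1}" by (auto simp: turning_values_def)
  show ?thesis
  proof (cases "t = 1")
    case True
    have lo: "f x \<le> f v" if "v \<in> ?V" "x \<in> {0..1}" "x < v" for v x
      using t(2)[OF that(1,2)] that(3) True by (auto simp: zero_le_mult_iff)
    have hi: "f v \<le> f x" if "v \<in> ?V" "x \<in> {0..1}" "v < x" for v x
      using t(2)[OF that(1,2)] that(3) True by (auto simp: zero_le_mult_iff)
    have fixV: "f v = v" if v: "v \<in> ?V" for v
    proof (rule ccontr)
      assume "f v \<noteq> v"
      \<comment> \<open>For the least turning value moved by \<open>f\<close>, both its image and
        its preimage in \<open>?V\<close> are larger, against monotonicity.\<close>
      define B where "B = {v\<in>?V. f v \<noteq> v}"
      have "finite B" "B \<noteq> {}" using fin_tg v \<open>f v \<noteq> v\<close> by (auto simp: B_def)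
      then have "Min B \<in> B" and le: "\<And>x. x \<in> B \<Longrightarrow> Min B \<le> x" by auto
      then have m: "Min B \<in> ?V" "f (Min B) \<noteq> Min B" by (auto simp: B_def)
      have m3: "f x = x" if "x \<in> ?V" "x < Min B" for x
        using le[of x] that unfolding B_def by fastforce
      have fm: "f (Min B) \<in> ?V" using m(1) turning_values_permuted(1) by blast
      have gt: "f (Min B) > Min B"
      proof (rule ccontr)
        assume "\<not> ?thesis"
        then have "f (Min B) < Min B" using m(2) by linarith
        then have "f (f (Min B)) = f (Min B)" using m3 fm by blast
        then show False using turning_values_permuted(2) fm m(1,2) by (metis inj_onD)
      qed
      obtain u where u: "u \<in> ?V" "f u = Min B" using m(1) turning_values_permuted(1) by (metis imageE)
      have "u \<noteq> Min B" using u m(2) by blast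
      then have "u > Min B" using m3[OF u(1)] u(2) by linarith
      then have "f (Min B) \<le> f u" using hi[OF m(1), of u] u(1) VI by blast
      then show False using gt u by linarith
    qed
    show ?thesis using fixing fixV lo hi by metis
  next
    case False
    then have t1: "t = -1" using t by auto
    show ?thesis
    proof (rule reversing)
      fix v x :: real assume *: "v \<in> ?V" "x \<in> {0..1}"
      have **: "0 \<le> (f v - f x) * (x - v)" using t(2)[OF *] t1 by simp
      show "f v \<le> f x" if "x < v" using ** that by (auto simp: zero_le_mult_iff)
      show "f x \<le> f v" if "v < x" using ** that by (auto simp: zero_le_mult_iff)
    qed
  qed
qed

end

subsection \<open>Regions with a single inverse branch\<close>

lemma compact_has_max:
  fixes S :: "real set"
  assumes "compact S" "S \<noteq> {}"
  obtains s where "s \<in> S" "\<And>x. x \<in> S \<Longrightarrow> x \<le> s"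
  using compact_attains_sup[OF assms] by blast

lemma compact_has_min:
  fixes S :: "real set"
  assumes "compact S" "S \<noteq> {}"
  obtains s where "s \<in> S" "\<And>x. x \<in> S \<Longrightarrow> s \<le> x"
  using compact_attains_inf[OF assms] by blast

lemma compact_Collect_le:
  fixes h k :: "real \<Rightarrow> real"
  assumes "compact S" "continuous_on S h" "continuous_on S k"
  shows "compact {x\<in>S. h x \<le> k x}"
  using compact_Int_closed[OF assms(1) continuous_on_closed_Collect_le[OF assms(2,3) compact_imp_closed[OF assms(1)]]]
  by (simp add: Int_def Collect_conj_eq[symmetric] conj_commute cong: conj_cong)

lemma compact_Collect_eq:
  fixes h k :: "real \<Rightarrow> real"
  assumes "compact S" "continuous_on S h" "continuous_on S k"
  shows "compact {x\<in>S. h x = k x}"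
proof -
  have "{x\<in>S. h x = k x} = {x\<in>{x\<in>S. h x \<le> k x}. k x \<le> h x}" by auto
  moreover have "compact {x\<in>{x\<in>S. h x \<le> k x}. k x \<le> h x}"
    by (intro compact_Collect_le assms continuous_on_subset[OF assms(2)] continuous_on_subset[OF assms(3)]) auto
  ultimately show ?thesis by simp
qed

text \<open>The Knaster-Tarski argument: the largest \<open>x\<close> with
  \<open>x \<le> k x\<close> is fixed. The set is a general compact one because the lemma is meant
  for the fixed point set of a commuting map.\<close>

lemma mono_on_compact_fixed_point:
  fixes k :: "real \<Rightarrow> real"
  assumes "compact A" "A \<noteq> {}" "continuous_on A k" "k ` A \<subseteq> A" "mono_on A k"
  obtains q where "q \<in> A" "k q = q"
proof -
  let ?S = "{x\<in>A. x \<le> k x}"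
  obtain a where a: "a \<in> A" "\<And>x. x \<in> A \<Longrightarrow> a \<le> x" using compact_has_min[OF assms(1,2)] by metis
  have "compact ?S" by (intro compact_Collect_le assms continuous_intros)
  moreover have "a \<in> ?S" using a assms(4) by auto
  ultimately obtain s where s: "s \<in> ?S" "\<And>x. x \<in> ?S \<Longrightarrow> x \<le> s" using compact_has_max by blast
  have "k s \<in> A" using s assms(4) by auto
  moreover have "k s \<le> k (k s)" using assms(5) s \<open>k s \<in> A\<close> by (auto simp: mono_on_def)
  ultimately have "k s \<le> s" using s(2) by auto
  then show ?thesis using that s by auto
qed

lemma interval_self_map_fixed_point:
  fixes h :: "real \<Rightarrow> real"
  assumes "a \<le> b" "continuous_on {a..b} h" "a \<le> h a" "h b \<le> b"
  obtains q where "q \<in> {a..b}" "h q = q"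
proof -
  have "\<exists>z\<in>{a..b}. h z - z = 0"
    using assms by (intro ivt_between continuous_intros) auto
  then show ?thesis using that by auto
qed

text \<open>Otherwise \<open>w\<close> would lie between two points of the interval
  \<open>K\<close>.\<close>

lemma ext_value_beyond:
  fixes K :: "real set"
  assumes "is_interval K" "u \<in> K" "w \<notin> K" "s * u < s * w" "k \<in> K" "s \<in> {1,-1}"
  shows "s * k < s * w"
proof (rule ccontr)
  assume "\<not> ?thesis"
  then have "u \<le> w \<and> w \<le> k \<or> k \<le> w \<and> w \<le> u" using assms(4,6) by auto
  then have "w \<in> K" using assms mem_is_interval_1_I by blast
  then show False using assms by simp
qed

text \<open>Over an interval without extremal values, two preimages of one point force the graph to
  sweep across the whole interval at least twice.\<close>

lemma two_preimages_spread:
  assumes cont: "continuous_on {0..1} h" and fin: "\<And>u. finite {x\<in>{0..1}. h x = u}"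
    and K: "is_interval K" "\<And>c s. s \<in> {1,-1} \<Longrightarrow> loc_ext s h c \<Longrightarrow> h c \<notin> K"
    and xy: "x \<in> {0..1}" "y \<in> {0..1}" "x < y" "h x = u" "h y = u" and u: "u \<in> K" "u' \<in> K"
  shows "\<exists>a\<in>{0..1}. \<exists>b\<in>{0..1}. a < b \<and> h a = u' \<and> h b = u'"
proof -
  have cr: "\<exists>t\<in>{1,-1}. crosses t h z" if "z \<in> {0..1}" "h z = u" for z
    using loc_ext_or_crosses[OF cont fin that(1)] K(2) u(1) that(2) by metis
  obtain t where t: "t \<in> {1,-1}" "crosses t h x" using cr xy by blast
  obtain r where r: "r \<in> {1,-1}" "crosses r h y" using cr xy by blast
  obtain d where d: "d > 0"
    "\<And>z. z \<in> {0..1} \<Longrightarrow> \<bar>z - x\<bar> < d \<Longrightarrow> z \<noteq> x \<Longrightarrow> 0 < t * (h z - u) * (z - x)"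
    and x01: "0 < x" "x < 1"
    using t(2) xy(4) unfolding crosses_def by auto
  obtain e where e: "e > 0"
    "\<And>z. z \<in> {0..1} \<Longrightarrow> \<bar>z - y\<bar> < e \<Longrightarrow> z \<noteq> y \<Longrightarrow> 0 < r * (h z - u) * (z - y)"
    and y01: "0 < y" "y < 1"
    using r(2) xy(5) unfolding crosses_def by auto
  have ct: "continuous_on S (\<lambda>z. t * h z)" if "S \<subseteq> {0..1}" for S
    using continuous_on_subset[OF cont that] by (intro continuous_intros)
  obtain c where c: "c \<in> {x..y}" "\<And>z. z \<in> {x..y} \<Longrightarrow> t * h z \<le> t * h c"
    using continuous_attains_sup[OF compact_Icc _ ct[of "{x..y}"]] xy x01 y01 by fastforce
  \<comment> \<open>Just to the right of \<open>x\<close> the function \<open>t * h\<close> exceeds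
    \<open>t * u\<close>, so its maximum over \<open>{x..y}\<close> is attained in the
    interior.\<close>
  define x1 where "x1 = min y (x + d / 2)"
  have "0 < t * (h x1 - u) * (x1 - x)"
    by (rule d(2)) (use xy d(1) in \<open>auto simp: x1_def min_def\<close>)
  moreover have "0 < x1 - x" "x1 \<in> {x..y}" using xy d(1) by (auto simp: x1_def)
  ultimately have "0 < t * (h x1 - u)" "t * h x1 \<le> t * h c" using zero_less_mult_pos2 c(2) by blast+
  then have tc: "t * u < t * h c" by (simp add: right_diff_distrib)
  then have "c \<noteq> x" "c \<noteq> y" using xy(4,5) by auto
  then have cxy: "x < c" "c < y" using c(1) by auto
  have "loc_ext t h c" by (rule loc_extI[OF _ cxy]) (use c x01 y01 in auto)
  then have "h c \<notin> K" using K(2) t(1) by blast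
  then have hc: "t * u' < t * h c" using ext_value_beyond[OF K(1) u(1) _ tc u(2) t(1)] by blast
  \<comment> \<open>These are the minima of \<open>t * h\<close> on either side of the peak
    \<open>c\<close>. Both lie below the level \<open>u\<close>, hence beyond \<open>K\<close>, so
    \<open>u'\<close> is attained between each of them and \<open>c\<close>.\<close>
  obtain c1 where c1: "c1 \<in> {0..c}" "\<And>z. z \<in> {0..c} \<Longrightarrow> t * h c1 \<le> t * h z"
    using continuous_attains_inf[OF compact_Icc _ ct[of "{0..c}"]] cxy x01 y01 by fastforce
  obtain c2 where c2: "c2 \<in> {c..1}" "\<And>z. z \<in> {c..1} \<Longrightarrow> t * h c2 \<le> t * h z"
    using continuous_attains_inf[OF compact_Icc _ ct[of "{c..1}"]] cxy x01 y01 by fastforce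
  \<comment> \<open>The bounds \<open>lo\<close> and \<open>hi\<close> may lie outside [0,1], so
    that minima at 0 and 1 are covered too.\<close>
  have below: "t * h c' < t * u'"
    if "c' \<in> {0..1}" "lo < c'" "c' < hi" "t * h c' < t * u"
      "\<And>z. z \<in> {0..1} \<Longrightarrow> lo < z \<Longrightarrow> z < hi \<Longrightarrow> t * h c' \<le> t * h z" for c' lo hi
  proof -
    have "loc_ext (- t) h c'" using that by (intro loc_extI[of c' lo hi]) auto
    then have "h c' \<notin> K" using K(2)[of "-t"] t(1) by auto
    then show "t * h c' < t * u'"
      using ext_value_beyond[OF K(1) u(1) _ _ u(2), of "h c'" "- t"] that(4) t(1) by auto
  qed
  define x2 where "x2 = max 0 (x - d / 2)"
  have x2: "x2 < x" "x2 \<in> {0..1}" "\<bar>x2 - x\<bar> < d" using x01 d(1) by (auto simp: x2_def max_def)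
  have "t * (h x2 - u) < 0"
    using d(2)[OF x2(2,3)] x2(1) zero_less_mult_iff[of "t * (h x2 - u)" "x2 - x"] by simp
  then have "t * h x2 < t * u" by (simp add: right_diff_distrib)
  moreover have "x2 \<in> {0..c}" using x2 cxy by auto
  ultimately have lt1: "t * h c1 < t * u" using c1(2) by force
  have "c1 \<noteq> c" using lt1 tc by auto
  then have "c1 < c" using c1(1) by auto
  then have b1: "t * h c1 < t * u'"
    using c1 cxy y01 lt1 by (intro below[of c1 "-1" c]) auto
  have "\<exists>z\<in>{c1..c}. t * h z = t * u'"
    using b1 hc \<open>c1 < c\<close> c1(1) cxy y01 by (intro ivt_between ct) auto
  then obtain a where a: "a \<in> {c1..c}" "t * h a = t * u'" by blast
  define y1 where "y1 = max c (y - e / 2)"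
  define y2 where "y2 = min 1 (y + e / 2)"
  have y1: "y1 < y" "y1 \<in> {0..1}" "\<bar>y1 - y\<bar> < e" "y1 \<in> {c..1}"
    using x01 y01 e(1) cxy by (auto simp: y1_def max_def)
  have y2: "y < y2" "y2 \<in> {0..1}" "\<bar>y2 - y\<bar> < e" "y2 \<in> {c..1}"
    using x01 y01 e(1) cxy by (auto simp: y2_def min_def)
  \<comment> \<open>Whatever its direction, the crossing at \<open>y\<close> goes below the level on
    one side.\<close>
  have "t * h y1 < t * u \<or> t * h y2 < t * u"
    using e(2)[OF y1(2,3)] e(2)[OF y2(2,3)] y1(1) y2(1) t(1) r(1)
    by (auto simp: zero_less_mult_iff)
  then have lt2: "t * h c2 < t * u" using c2(2)[OF y1(4)] c2(2)[OF y2(4)] by linarith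
  have "c2 \<noteq> c" using lt2 tc by auto
  then have "c < c2" using c2(1) by auto
  then have b2: "t * h c2 < t * u'"
    using c2 cxy x01 lt2 by (intro below[of c2 c 2]) auto
  have "\<exists>z\<in>{c..c2}. t * h z = t * u'"
    using b2 hc \<open>c < c2\<close> c2(1) cxy x01 by (intro ivt_between ct) auto
  then obtain b where b: "b \<in> {c..c2}" "t * h b = t * u'" by blast
  have hab: "h a = u'" "h b = u'" using a(2) b(2) t(1) by auto
  moreover have "a \<noteq> c" using hab hc by auto
  ultimately show ?thesis
    using a(1) b(1) c1(1) c2(1) cxy x01 y01 by (intro bexI[of _ a] bexI[of _ b]) auto
qed

section \<open>Common fixed points from a single inverse branch\<close>

context strongly_commuting
begin

text \<open>The largest element of \<open>{x. f x = x \<and> x \<le> g x}\<close> is a fixed point of \<open>g\<close> if \<open>g\<close> moves \<open>v\<close> to the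
  right; otherwise one argues with \<open>g x \<le> x\<close> and the inverse branch of \<open>g\<close>, starting at the
  last preimage \<open>x1\<close> of \<open>v\<close>, which \<open>f\<close> fixes by continuity.\<close>

lemma common_fixed_point_between:
  assumes vw: "v < w" "v \<in> {0..1}" "w \<in> {0..1}" "f v = v" "g w = w" "g v < w"
    and uniq: "\<And>x y. x \<in> {0..1} \<Longrightarrow> y \<in> {0..1} \<Longrightarrow> g x = g y \<Longrightarrow> v < g x \<Longrightarrow> g x \<le> w \<Longrightarrow> x = y"
    and above: "\<And>u. u \<in> {0..1} \<Longrightarrow> v < u \<Longrightarrow> v < f u"
  shows "\<exists>x\<in>{0..1}. f x = x \<and> g x = x"
proof -
  have cont: "continuous_on {a..b} f" "continuous_on {a..b} g" if "0 \<le> a" "b \<le> 1" for a b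
    using that continuous_on_subset[OF cont_f] continuous_on_subset[OF cont_g] by auto
  have cpt: "compact {x\<in>{a..b}. f x = x}" if "0 \<le> a" "b \<le> 1" for a b
    by (intro compact_Collect_eq cont that continuous_intros) simp
  have ivt: "\<exists>z\<in>{a..b}. g z = u" if "0 \<le> a" "a \<le> b" "b \<le> 1" "g a \<le> u \<and> u \<le> g b \<or> g b \<le> u \<and> u \<le> g a" for a b u
    using that by (intro ivt_between cont) auto
  show ?thesis
  proof (cases "v \<le> g v")
    case True
    let ?S = "{x\<in>{x\<in>{v..w}. f x = x}. x \<le> g x}"
    have "continuous_on {x\<in>{v..w}. f x = x} g"
      using vw by (intro continuous_on_subset[OF cont_g]) auto
    then have "compact ?S" using vw by (intro compact_Collect_le cpt continuous_intros) auto
    moreover have "v \<in> ?S" using True vw by auto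
    ultimately obtain s where s: "s \<in> ?S" "\<And>x. x \<in> ?S \<Longrightarrow> x \<le> s" using compact_has_max by blast
    have sI: "s \<in> {0..1}" "v \<le> s" "s \<le> w" "f s = s" "s \<le> g s" using s(1) vw by auto
    define y where "y = g s"
    have y: "y \<in> {0..1}" "f y = y" "s \<le> y" using g_in comm[of s] sI by (auto simp: y_def)
    \<comment> \<open>Since \<open>y = g s\<close> is again fixed by \<open>f\<close> and
      \<open>s \<le> y\<close>, it is enough to show that \<open>y\<close> belongs to
      \<open>?S\<close>.\<close>
    have yw: "y \<le> w"
    proof (rule ccontr)
      assume "\<not> y \<le> w"
      then obtain z where z: "z \<in> {v..s}" "g z = w"
        using ivt[of v s w] vw sI by (auto simp: y_def)
      then have "z = w" using uniq[of z w] vw sI by auto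
      then show False using z(1) sI \<open>\<not> y \<le> w\<close> vw(5) by (auto simp: y_def)
    qed
    have "y \<le> g y"
    proof (rule ccontr)
      assume lt: "\<not> y \<le> g y"
      then obtain z where z: "z \<in> {y..w}" "g z = y" using ivt[of y w y] vw yw y by auto
      have "y \<noteq> v" using lt sI y y_def by force
      then have "z = s" using uniq[of z s] z sI vw y yw by (auto simp: y_def)
      then have "s = y" using z y by auto
      then show False using lt y_def by simp
    qed
    then have "y \<le> s" using s(2)[of y] y yw sI by auto
    then show ?thesis using y sI y_def by force
  next
    case False
    let ?Z = "{x\<in>{v..w}. g x = v}"
    have "\<exists>z\<in>{v..w}. g z = v" using ivt[of v w v] False vw by auto
    then have ne: "?Z \<noteq> {}" by blast
    have cp: "compact ?Z" using vw by (intro compact_Collect_eq cont continuous_intros) auto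
    obtain x1 where "x1 \<in> ?Z" and max: "\<And>x. x \<in> ?Z \<Longrightarrow> x \<le> x1"
      using compact_has_max[OF cp ne] by metis
    then have x1: "x1 \<in> {v..w}" "g x1 = v" by blast+
    have x1_max: "x \<le> x1" if "x \<in> {v..w}" "g x = v" for x using max that by blast
    have x1w: "x1 < w" using x1 vw by (auto simp: order.order_iff_strict)
    have x1I: "x1 \<in> {0..1}" using x1 vw by auto
    have gpos: "v < g x" if "x1 < x" "x \<le> w" for x
    proof (rule ccontr)
      assume "\<not> v < g x"
      moreover have "0 \<le> x" "x \<le> w" "w \<le> 1" "v \<le> g w" using that x1I vw by auto
      ultimately obtain z where "z \<in> {x..w}" "g z = v" using ivt[of x w v] by auto
      then show False using x1(1) x1_max[of z] that by auto
    qed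
    \<comment> \<open>If \<open>f x1\<close> lay outside, so would \<open>f y\<close> for
      \<open>y\<close> slightly to the right of \<open>x1\<close>. But
      \<open>g (f y) = f (g y)\<close> lies strictly between \<open>v\<close> and \<open>w\<close>,
      and by intermediate values the only preimage of such a point under \<open>g\<close> lies in
      \<open>{x1..w}\<close>.\<close>
    have "f x1 \<in> {x1..w}"
    proof (rule ccontr)
      assume no: "f x1 \<notin> {x1..w}"
      obtain \<epsilon> where \<epsilon>: "\<epsilon> > 0" "\<And>z. \<bar>z - f x1\<bar> < \<epsilon> \<Longrightarrow> z \<notin> {x1..w}"
        using no by (intro that[of "if f x1 < x1 then x1 - f x1 else f x1 - w"]) (auto split: if_splits)
      obtain d where d: "d > 0" "\<And>y. y \<in> {0..1} \<Longrightarrow> \<bar>y - x1\<bar> < d \<Longrightarrow> \<bar>f y - f x1\<bar> < \<epsilon>"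
        using continuous_on_real_near[OF cont_f x1I \<epsilon>(1)] by blast
      have cfg: "continuous_on {0..1} (\<lambda>y. f (g y))"
        using continuous_on_compose2[OF cont_f cont_g] g_in by blast
      have "f (g x1) = v" using x1 vw by simp
      then obtain d' where d': "d' > 0" "\<And>y. y \<in> {0..1} \<Longrightarrow> \<bar>y - x1\<bar> < d' \<Longrightarrow> \<bar>f (g y) - v\<bar> < w - v"
        using continuous_on_real_near[OF cfg x1I, of "w - v"] vw(1) by auto
      define y where "y = min w (x1 + min d d' / 2)"
      have y: "x1 < y" "y \<le> w" "\<bar>y - x1\<bar> < d" "\<bar>y - x1\<bar> < d'" "y \<in> {0..1}"
        using x1w x1I d(1) d'(1) vw(3) unfolding y_def by (auto simp: min_def)
      have "v < f (g y)" using above[of "g y"] gpos[OF y(1,2)] g_in[OF y(5)] by blast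
      moreover have "f (g y) < w" using d'(2)[OF y(5,4)] by auto
      ultimately obtain z where z: "z \<in> {x1..w}" "g z = f (g y)"
        using ivt[of x1 w "f (g y)"] x1 vw x1w by auto
      have "g (f y) = f (g y)" by (rule comm[OF y(5), symmetric])
      moreover have "z \<in> {0..1}" using z(1) x1I vw(3) by simp
      ultimately have "f y = z"
        using uniq[OF f_in[OF y(5)] \<open>z \<in> {0..1}\<close>] \<open>v < f (g y)\<close> \<open>f (g y) < w\<close> z(2) by linarith
      then show False using z(1) \<epsilon>(2)[OF d(2)[OF y(5,3)]] by blast
    qed
    moreover have "g (f x1) = v" using comm[OF x1I] x1 vw by simp
    ultimately have fx1: "f x1 = x1" using x1(1) x1_max[of "f x1"] by auto
    let ?S = "{x\<in>{x\<in>{x1..w}. f x = x}. g x \<le> x}"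
    have "continuous_on {x\<in>{x1..w}. f x = x} g"
      using vw x1I by (intro continuous_on_subset[OF cont_g]) auto
    then have "compact ?S" using vw x1I by (intro compact_Collect_le cpt continuous_intros) auto
    moreover have "x1 \<in> ?S" using x1 fx1 by auto
    ultimately obtain s where s: "s \<in> ?S" "\<And>x. x \<in> ?S \<Longrightarrow> x \<le> s" using compact_has_max by blast
    have sI: "s \<in> {0..1}" "x1 \<le> s" "s \<le> w" "f s = s" "g s \<le> s" using s(1) vw x1I by auto
    obtain y where y: "y \<in> {s..w}" "g y = s" using ivt[of s w s] sI vw by auto
    have "s \<noteq> v" using sI x1 False vw by auto
    then have "v < s" using sI x1 by auto
    have yI: "y \<in> {0..1}" using y sI vw by auto
    have "g (f y) = g y" using comm[OF yI] y sI by simp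
    then have "f y = y" using uniq[of "f y" y] f_in[OF yI] yI y sI \<open>v < s\<close> by auto
    then have "y \<le> s" using s(2)[of y] y sI by auto
    then have "y = s" using y by auto
    then show ?thesis using y sI by auto
  qed
qed

text \<open>Let \<open>{a..b}\<close> be the hull of the fixed point set \<open>A\<close> of
  \<open>f\<close>. Single preimages make \<open>g\<close> map the hull into itself and strictly
  monotone there. If increasing, \<open>g\<close> has a fixed point in \<open>A\<close>, which it
  preserves; if decreasing, it has a single fixed point in the hull, and \<open>f\<close> fixes that
  one.\<close>

lemma common_fixed_point_single_preimage:
  assumes uniq: "\<And>p q x y. p \<in> {0..1} \<Longrightarrow> q \<in> {0..1} \<Longrightarrow> f p = p \<Longrightarrow> f q = q \<Longrightarrow>
    x \<in> {0..1} \<Longrightarrow> y \<in> {0..1} \<Longrightarrow> p \<le> g x \<Longrightarrow> g x \<le> q \<Longrightarrow> g x = g y \<Longrightarrow> x = y"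
  shows "\<exists>x\<in>{0..1}. f x = x \<and> g x = x"
proof -
  define A where "A = {x\<in>{0..1}. f x = x}"
  have "compact A" unfolding A_def by (intro compact_Collect_eq cont_f continuous_intros) simp
  have "A \<noteq> {}"
    using interval_self_map_fixed_point[OF _ cont_f] f_in[of 0] f_in[of 1] by (force simp: A_def)
  obtain a where a: "a \<in> A" "\<And>x. x \<in> A \<Longrightarrow> a \<le> x" using compact_has_min[OF \<open>compact A\<close> \<open>A \<noteq> {}\<close>] by blast
  obtain b where b: "b \<in> A" "\<And>x. x \<in> A \<Longrightarrow> x \<le> b" using compact_has_max[OF \<open>compact A\<close> \<open>A \<noteq> {}\<close>] by blast
  have ab: "a \<in> {0..1}" "b \<in> {0..1}" "f a = a" "f b = b" "a \<le> b" using a b by (auto simp: A_def)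
  have uniq': "x = y" if "x \<in> {0..1}" "y \<in> {0..1}" "g x \<in> {a..b}" "g x = g y" for x y
    using uniq[of a b x y] that ab by auto
  have gA: "g x \<in> A" if "x \<in> A" for x using that comm[of x] g_in[of x] by (auto simp: A_def)
  then have gab: "g a \<in> {a..b}" "g b \<in> {a..b}" using a b by auto
  have cont: "continuous_on {x..y} g" if "0 \<le> x" "y \<le> 1" for x y
    using that by (intro continuous_on_subset[OF cont_g]) auto
  have ivt: "\<exists>z\<in>{x..y}. g z = u" if "0 \<le> x" "x \<le> y" "y \<le> 1" "g x \<le> u \<and> u \<le> g y \<or> g y \<le> u \<and> u \<le> g x" for x y u
    using that by (intro ivt_between cont) auto
  \<comment> \<open>A value outside the hull would force \<open>g\<close> to take an end value
    \<open>u\<close> on both sides of \<open>x\<close>, hence at \<open>x\<close> itself.\<close>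
  have gH: "g x \<in> {a..b}" if x: "x \<in> {a..b}" for x
  proof (rule ccontr)
    assume out: "g x \<notin> {a..b}"
    then obtain u where u: "u \<in> {a..b}" "g x < u \<and> u \<le> g a \<and> u \<le> g b \<or> u < g x \<and> g a \<le> u \<and> g b \<le> u"
      using gab by (intro that[of "if g x < a then a else b"]) auto
    have "\<exists>z\<in>{a..x}. g z = u" using u x ab by (intro ivt) auto
    then obtain y where y: "y \<in> {a..x}" "g y = u" by blast
    have "\<exists>z\<in>{x..b}. g z = u" using u x ab by (intro ivt) auto
    then obtain z where z: "z \<in> {x..b}" "g z = u" by blast
    have "y = z" using uniq'[of y z] y z u x ab by auto
    then have "g x = u" using y z by auto
    then show False using u by auto
  qed
  have "inj_on g {a..b}" 
  proof (rule inj_onI)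
    fix x y assume "x \<in> {a..b}" "y \<in> {a..b}" "g x = g y"
    then show "x = y" using uniq'[of x y] gH[of x] ab by simp
  qed
  then have "strict_mono_on {a..b} g \<or> strict_antimono_on {a..b} g"
    using injective_eq_monotone_map[of "{a..b}" g] cont ab by (auto simp: is_interval_cc)
  then show ?thesis
  proof
    assume mono: "strict_mono_on {a..b} g"
    have AH: "A \<subseteq> {a..b}" using a b by auto
    have "mono_on A g"
      by (rule monotone_on_subset[OF strict_mono_on_imp_mono_on[OF mono] AH])
    moreover have "continuous_on A g" by (rule continuous_on_subset[OF cont_g]) (auto simp: A_def)
    ultimately obtain q where "q \<in> A" "g q = q"
      using mono_on_compact_fixed_point[OF \<open>compact A\<close> \<open>A \<noteq> {}\<close>] gA by blast
    then show ?thesis by (auto simp: A_def)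
  next
    assume anti: "strict_antimono_on {a..b} g"
    have dec: "g y < g x" if "x \<in> {a..b}" "y \<in> {a..b}" "x < y" for x y
      using anti that by (auto simp: monotone_on_def)
    obtain q where q: "q \<in> {a..b}" "g q = q"
      using interval_self_map_fixed_point[of a b g] gab ab cont by auto
    have qI: "q \<in> {0..1}" using q ab by auto
    \<comment> \<open>\<open>r\<close> is again fixed by \<open>g\<close>. If it is outside the
      hull, \<open>g\<close> takes the value \<open>q\<close> between \<open>r\<close> and the
      nearer end of the hull, which identifies \<open>q\<close> with that end, a fixed point of
      \<open>f\<close>.\<close>
    define r where "r = f q"
    have r: "r \<in> {0..1}" "g r = r" using f_in[OF qI] comm[OF qI] q by (auto simp: r_def)
    have r_eq: "r = q" if "r \<in> {a..b}"
      using dec[of r q] dec[of q r] q r that by (cases r q rule: linorder_cases) auto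
    have "r = q"
    proof -
      consider "r < a" | "r \<in> {a..b}" | "b < r" by force
      then show ?thesis
      proof cases
        case 1
        have "q \<le> g a" using dec[of a q] q ab by (cases "a = q") auto
        then obtain z where z: "z \<in> {r..a}" "g z = q" using ivt[of r a q] 1 r q ab by auto
        then have "z = q" using uniq'[of z q] q qI r ab by auto
        then have "q = a" using z q by auto
        then show ?thesis using ab r_def by simp
      next
        case 3
        have "g b \<le> q" using dec[of q b] q ab by (cases "b = q") auto
        then obtain z where z: "z \<in> {b..r}" "g z = q" using ivt[of b r q] 3 r q ab by auto
        then have "z = q" using uniq'[of z q] q qI r ab by auto
        then have "q = b" using z q by auto
        then show ?thesis using ab r_def by simp
      qed (rule r_eq)
    qed
    then show ?thesis using q qI r_def by auto
  qed
qed

end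

subsection \<open>Maps without interior extremal values\<close>

lemma ex_rank:
  fixes E :: "real set"
  assumes "finite E" "0 < k" "k \<le> card E"
  shows "\<exists>l\<in>E. card (E \<inter> {..l}) = k"
  using assms
proof (induction E rule: finite_linorder_max_induct)
  case (insert b A)
  have b: "b \<notin> A" using insert.hyps by auto
  show ?case
  proof (cases "k \<le> card A")
    case True
    then obtain l where l: "l \<in> A" "card (A \<inter> {..l}) = k" using insert by blast
    moreover have "insert b A \<inter> {..l} = A \<inter> {..l}" using l insert.hyps by force
    ultimately show ?thesis by (metis insertI2)
  next
    case False
    then have "k = card (insert b A)" using insert b by simp
    moreover have "insert b A \<inter> {..b} = insert b A" using insert.hyps by force
    ultimately show ?thesis by (metis insertI1)
  qed
qed simp

lemma median_unique:
  fixes S :: "real set"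
  assumes "finite S" "x \<in> S" "y \<in> S"
    and "card {z\<in>S. z < x} = card {z\<in>S. x < z}" "card {z\<in>S. z < y} = card {z\<in>S. y < z}"
  shows "x = y"
proof -
  have no: "\<not> p < q" if "p \<in> S" "q \<in> S" "card {z\<in>S. z < p} = card {z\<in>S. p < z}"
    "card {z\<in>S. z < q} = card {z\<in>S. q < z}" for p q
  proof
    assume "p < q"
    have "{z\<in>S. z < p} \<subset> {z\<in>S. z < q}" "{z\<in>S. q < z} \<subset> {z\<in>S. p < z}"
      using \<open>p < q\<close> that(1,2) by force+
    then have "card {z\<in>S. z < p} < card {z\<in>S. z < q}" "card {z\<in>S. q < z} < card {z\<in>S. p < z}"
      using assms(1) by (auto intro!: psubset_card_mono)
    then show False using that(3,4) by simp
  qed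
  have "\<not> x < y" by (rule no) fact+
  moreover have "\<not> y < x" by (rule no) fact+
  ultimately show ?thesis by simp
qed

text \<open>The tent maps are typical. By \<open>interior_ext\<close> interior extremal values are
  end points of the interval, so every monotone lap covers all of \<open>{a..b}\<close>.\<close>

locale full_map =
  fixes h :: "real \<Rightarrow> real" and a b :: real
  assumes ab: "a < b" and cont: "continuous_on {a..b} h" and into: "h ` {a..b} \<subseteq> {a..b}"
    and fin: "finite {x\<in>{a..b}. h x = u}" and ends: "h a \<in> {a,b}" "h b \<in> {a,b}"
    and interior_ext: "s \<in> {1,-1::real} \<Longrightarrow> a \<le> x \<Longrightarrow> x < c \<Longrightarrow> c < y \<Longrightarrow> y \<le> b \<Longrightarrow>
      (\<And>z. z \<in> {x..y} \<Longrightarrow> s * h z \<le> s * h c) \<Longrightarrow> h c \<in> {a,b}"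
begin

text \<open>These points cut \<open>{a..b}\<close> into the laps of \<open>h\<close>.\<close>

definition "E = {x\<in>{a..b}. h x \<in> {a,b}}"

definition "fibre u = {x\<in>{a..b}. h x = u}"

lemma finite_E: "finite E"
proof -
  have "E = {x\<in>{a..b}. h x = a} \<union> {x\<in>{a..b}. h x = b}" by (auto simp: E_def)
  then show ?thesis using fin[of a] fin[of b] by simp
qed

lemma finite_fibre: "finite (fibre u)"
  using fin[of u] by (simp add: fibre_def)

lemma h_in: "x \<in> {a..b} \<Longrightarrow> h x \<in> {a..b}"
  using into by blast

lemma ends_in_E: "a \<in> E" "b \<in> E"
  using ab ends by (auto simp: E_def)

text \<open>Two equal values would enclose an interior extremum, which by
  \<open>interior_ext\<close> is a point of \<open>E\<close> inside the gap.\<close>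

lemma inj_on_gap:
  assumes "s \<in> E" "t \<in> E" "E \<inter> {s<..<t} = {}"
  shows "inj_on h {s..t}"
proof (rule inj_onI, rule ccontr)
  have no: False if xy: "x \<in> {s..t}" "y \<in> {s..t}" "h x = h y" "x < y" for x y
  proof -
    have sub: "{x..y} \<subseteq> {a..b}" using xy assms(1,2) by (auto simp: E_def)
    obtain r c where c: "r \<in> {1,-1::real}" "c \<in> {x<..<y}" "\<And>z. z \<in> {x..y} \<Longrightarrow> r * h z \<le> r * h c"
      using interior_extremum[OF xy(4) continuous_on_subset[OF cont sub] xy(3)] by (metis (full_types))
    have "h c \<in> {a,b}"
      by (rule interior_ext[OF c(1), of x c y]) (use c xy assms(1,2) in \<open>auto simp: E_def\<close>)
    then have "c \<in> E \<inter> {s<..<t}" using c(2) xy(1,2) sub by (auto simp: E_def)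
    then show False using assms(3) by blast
  qed
  fix x y assume "x \<in> {s..t}" "y \<in> {s..t}" "h x = h y" "x \<noteq> y"
  then show False using no[of x y] no[of y x] by (metis linorder_neqE)
qed

lemma gap_values:
  assumes "s \<in> E" "t \<in> E" "E \<inter> {s<..<t} = {}" "s < t"
  shows "h s \<noteq> h t" "h ` {s..t} = {a..b}"
    "u \<in> {a<..<b} \<Longrightarrow> card (fibre u \<inter> {s..t}) = 1"
proof -
  have inj: "inj_on h {s..t}" by (rule inj_on_gap[OF assms(1-3)])
  show ne: "h s \<noteq> h t" using inj_onD[OF inj, of s t] assms(4) by auto
  have sub: "{s..t} \<subseteq> {a..b}" using assms(1,2) by (auto simp: E_def)
  have hst: "h s \<in> {a,b}" "h t \<in> {a,b}" using assms(1,2) by (auto simp: E_def)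
  have ivt: "\<exists>z\<in>{s..t}. h z = u" if "u \<in> {a..b}" for u
    using ne that hst assms(4) ab by (intro ivt_between continuous_on_subset[OF cont sub]) auto
  then show "h ` {s..t} = {a..b}" using into sub by blast
  show "card (fibre u \<inter> {s..t}) = 1" if u: "u \<in> {a<..<b}"
  proof -
    obtain z where z: "z \<in> {s..t}" "h z = u" using ivt[of u] u by auto
    have "fibre u \<inter> {s..t} = {z}"
      using z inj sub by (auto simp: fibre_def inj_on_def)
    then show ?thesis by simp
  qed
qed

text \<open>Along consecutive points of \<open>E\<close> the values alternate between
  \<open>a\<close> and \<open>b\<close>, and each gap contributes one point to every fibre over an
  interior value. The induction splits off the first gap.\<close>

lemma count_between:
  assumes "s \<in> E" "t \<in> E" "s \<le> t"
  shows "(h s = h t \<longleftrightarrow> odd (card (E \<inter> {s..t}))) \<and>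
    (\<forall>u\<in>{a<..<b}. card (fibre u \<inter> {s..t}) + 1 = card (E \<inter> {s..t}))"
  using assms
proof (induction "card (E \<inter> {s..t})" arbitrary: s rule: less_induct)
  case less
  show ?case
  proof (cases "s = t")
    case True
    then have "E \<inter> {s..t} = {t}" using less.prems by auto
    moreover have "fibre u \<inter> {s..t} = {}" if "u \<in> {a<..<b}" for u
      using that True less.prems by (auto simp: E_def fibre_def)
    ultimately show ?thesis using True by simp
  next
    case False
    define e where "e = Min (E \<inter> {s<..t})"
    have fin: "finite (E \<inter> {s<..t})" "E \<inter> {s<..t} \<noteq> {}" using finite_E less.prems False by auto
    have e: "e \<in> E" "s < e" "e \<le> t" using Min_in[OF fin] by (auto simp: e_def)
    have Min_e: "e \<le> x" if "x \<in> E" "s < x" "x \<le> t" for x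
      using Min_le[OF fin(1), of x] that by (auto simp: e_def)
    then have gap: "E \<inter> {s<..<e} = {}" using e by force
    have eq: "E \<inter> {s..t} = insert s (E \<inter> {e..t})"
    proof (intro equalityI subsetI)
      fix x assume "x \<in> E \<inter> {s..t}"
      then show "x \<in> insert s (E \<inter> {e..t})" using Min_e[of x] by (cases "x = s") auto
    next
      fix x assume "x \<in> insert s (E \<inter> {e..t})"
      then show "x \<in> E \<inter> {s..t}" using less.prems e by auto
    qed
    then have card_E: "card (E \<inter> {s..t}) = Suc (card (E \<inter> {e..t}))"
      using finite_E e by (subst eq, subst card_insert_disjoint) auto
    have IH: "(h e = h t \<longleftrightarrow> odd (card (E \<inter> {e..t}))) \<and>
      (\<forall>u\<in>{a<..<b}. card (fibre u \<inter> {e..t}) + 1 = card (E \<inter> {e..t}))"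
      by (rule less.hyps) (use card_E e less.prems in auto)
    have "h s \<in> {a,b}" "h e \<in> {a,b}" "h t \<in> {a,b}" using less.prems(1,2) e(1) by (simp_all add: E_def)
    then have "h s = h t \<longleftrightarrow> h e \<noteq> h t"
      using gap_values(1)[OF less.prems(1) e(1) gap e(2)] by (metis insertE singletonD)
    moreover have "card (fibre u \<inter> {s..t}) = card (fibre u \<inter> {e..t}) + 1" if u: "u \<in> {a<..<b}" for u
    proof -
      have "e \<notin> fibre u" using e(1) u by (auto simp: E_def fibre_def)
      then have "fibre u \<inter> {s..t} = (fibre u \<inter> {s..e}) \<union> (fibre u \<inter> {e..t})"
        "(fibre u \<inter> {s..e}) \<inter> (fibre u \<inter> {e..t}) = {}"
        using e by (auto simp: order.order_iff_strict)
      then show ?thesis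
        using gap_values(3)[OF less.prems(1) e(1) gap e(2) u] finite_fibre by (simp add: card_Un_disjoint)
    qed
    ultimately show ?thesis using IH card_E by auto
  qed
qed

text \<open>\<open>F u\<close> is the median of the fibre over \<open>u\<close>, having \<open>k\<close> fibre points on either side. By the last
  clause, a fibre point outside the branch lies on one side of the whole branch.\<close>

definition middle_branch :: "(real \<Rightarrow> real) \<Rightarrow> nat \<Rightarrow> real \<Rightarrow> bool" where
  "middle_branch F k t \<longleftrightarrow>
     continuous_on {a..b} F \<and> F ` {a..b} \<subseteq> {a..b} \<and> (\<forall>u\<in>{a..b}. h (F u) = u) \<and>
     t \<in> {1,-1} \<and> (\<forall>x\<in>{a..b}. \<forall>y\<in>{a..b}. x < y \<longrightarrow> t * F x < t * F y) \<and>
     (\<forall>s\<in>{1,-1}. \<forall>u\<in>{a<..<b}. card {y\<in>fibre u. s * y < s * F u} = k \<and>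
       (\<forall>v\<in>{a<..<b}. \<forall>y\<in>fibre u. y \<noteq> F u \<longrightarrow> s * y < s * F v \<longleftrightarrow> s * y < s * F u))"

text \<open>Different end values make \<open>card E\<close> even, say \<open>2 * m\<close>, so the
  number of laps is odd. The middle lap \<open>{l..r}\<close> has \<open>m\<close> points of
  \<open>E\<close> up to \<open>l\<close> and \<open>m\<close> from \<open>r\<close> on; the inverse
  of \<open>h\<close> on it leaves \<open>m - 1\<close> points of each interior fibre on either
  side.\<close>

lemma ex_middle_branch:
  assumes ne: "h a \<noteq> h b"
  shows "\<exists>F k t. middle_branch F k t"
proof -
  have EI: "E \<subseteq> {a..b}" by (auto simp: E_def)
  then have "E \<inter> {a..b} = E" by blast
  then have "even (card E)" using count_between[OF ends_in_E] ne ab by auto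
  then obtain m where m: "card E = 2 * m" by blast
  have "card E \<noteq> 0" using finite_E ends_in_E by auto
  then have m0: "0 < m" using m by simp
  obtain l where l: "l \<in> E" "card (E \<inter> {..l}) = m" using ex_rank[OF finite_E m0] m by auto
  have "E \<inter> {l<..} \<noteq> {}"
  proof
    assume "E \<inter> {l<..} = {}"
    then have "E \<inter> {..l} = E" by force
    then show False using l m m0 by simp
  qed
  moreover have fin: "finite (E \<inter> {l<..})" using finite_E by simp
  ultimately have "Min (E \<inter> {l<..}) \<in> E \<inter> {l<..}" by (rule Min_in[rotated])
  then obtain r where r: "r \<in> E" "l < r" "r = Min (E \<inter> {l<..})" by blast
  have r_le: "r \<le> x" if "x \<in> E" "l < x" for x using Min_le[OF fin, of x] that r(3) by auto
  then have gap: "E \<inter> {l<..<r} = {}" by force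
  have "E = (E \<inter> {..l}) \<union> (E \<inter> {r..})" "(E \<inter> {..l}) \<inter> (E \<inter> {r..}) = {}"
    using r_le r(2) by force+
  then have "card E = card (E \<inter> {..l}) + card (E \<inter> {r..})"
    using finite_E by (metis card_Un_disjoint finite_Int)
  then have cr: "card (E \<inter> {r..}) = m" using l m by simp
  have "E \<inter> {a..l} = E \<inter> {..l}" "E \<inter> {r..b} = E \<inter> {r..}" using EI by auto
  then have cl': "card (E \<inter> {a..l}) = m" and cr': "card (E \<inter> {r..b}) = m" using l cr by auto
  have lr: "a \<le> l" "r \<le> b" using l r EI by auto
  have left: "card (fibre u \<inter> {a..l}) = m - 1" and right: "card (fibre u \<inter> {r..b}) = m - 1"
    if "u \<in> {a<..<b}" for u
    using bspec[OF conjunct2[OF count_between[OF ends_in_E(1) l(1) lr(1)]] that]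
      bspec[OF conjunct2[OF count_between[OF r(1) ends_in_E(2) lr(2)]] that] cl' cr' by linarith+
  have inj: "inj_on h {l..r}" by (rule inj_on_gap[OF l(1) r(1) gap])
  have img: "h ` {l..r} = {a..b}" by (rule gap_values(2)[OF l(1) r(1) gap r(2)])
  define F where "F = the_inv_into {l..r} h"
  have hF: "h (F u) = u" and F_in: "F u \<in> {l..r}" if "u \<in> {a..b}" for u
    using f_the_inv_into_f[OF inj, of u] the_inv_into_into[OF inj, of u "{l..r}"] that img
    by (auto simp: F_def)
  have Fh: "F (h x) = x" if "x \<in> {l..r}" for x using the_inv_into_f_f[OF inj that] by (simp add: F_def)
  have contF: "continuous_on {a..b} F"
    using continuous_on_inv_into[OF _ compact_Icc inj] continuous_on_subset[OF cont, of "{l..r}"] lr img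
    by (auto simp: F_def)
  have "inj_on F {a..b}" using hF by (metis inj_onI)
  then have "strict_mono_on {a..b} F \<or> strict_antimono_on {a..b} F"
    using injective_eq_monotone_map[of "{a..b}" F] contF by (auto simp: is_interval_cc)
  then have "\<exists>t\<in>{1,-1}. \<forall>x\<in>{a..b}. \<forall>y\<in>{a..b}. x < y \<longrightarrow> t * F x < t * F y"
    by (auto simp: monotone_on_def)
  then obtain t where t: "t \<in> {1,-1}" "\<forall>x\<in>{a..b}. \<forall>y\<in>{a..b}. x < y \<longrightarrow> t * F x < t * F y" by blast
  \<comment> \<open>The other fibre points avoid the whole middle lap, so comparing them with
    \<open>F v\<close> gives the same answer for every \<open>v\<close>.\<close>
  have sides: "y < l \<or> r < y" if "u \<in> {a<..<b}" "y \<in> fibre u" "y \<noteq> F u" for u y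
  proof (rule ccontr)
    assume "\<not> ?thesis"
    then have "F (h y) = y" by (intro Fh) auto
    then show False using that by (simp add: fibre_def)
  qed
  have not_lr: "y \<noteq> l" "y \<noteq> r" if "u \<in> {a<..<b}" "y \<in> fibre u" for u y
    using that l(1) r(1) by (auto simp: E_def fibre_def)
  have "card {y\<in>fibre u. s * y < s * F u} = m - 1 \<and>
       (\<forall>v\<in>{a<..<b}. \<forall>y\<in>fibre u. y \<noteq> F u \<longrightarrow> s * y < s * F v \<longleftrightarrow> s * y < s * F u)"
    if s: "s \<in> {1,-1}" and u: "u \<in> {a<..<b}" for s u
  proof
    have Fu: "l \<le> F u" "F u \<le> r" using F_in[of u] u by auto
    have "{y\<in>fibre u. y < F u} = fibre u \<inter> {a..l}"
    proof (intro equalityI subsetI)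
      fix y assume y: "y \<in> {y\<in>fibre u. y < F u}"
      then show "y \<in> fibre u \<inter> {a..l}" using sides[OF u, of y] Fu by (auto simp: fibre_def)
    next
      fix y assume y: "y \<in> fibre u \<inter> {a..l}"
      then show "y \<in> {y\<in>fibre u. y < F u}" using not_lr[OF u, of y] Fu by auto
    qed
    then have cl: "card {y\<in>fibre u. y < F u} = m - 1" using left[OF u] by simp
    have "{y\<in>fibre u. F u < y} = fibre u \<inter> {r..b}"
    proof (intro equalityI subsetI)
      fix y assume y: "y \<in> {y\<in>fibre u. F u < y}"
      then show "y \<in> fibre u \<inter> {r..b}" using sides[OF u, of y] Fu by (auto simp: fibre_def)
    next
      fix y assume y: "y \<in> fibre u \<inter> {r..b}"
      then show "y \<in> {y\<in>fibre u. F u < y}" using not_lr[OF u, of y] Fu by auto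
    qed
    then have "card {y\<in>fibre u. F u < y} = m - 1" using right[OF u] by simp
    with cl show "card {y\<in>fibre u. s * y < s * F u} = m - 1"
      using s by (elim insertE emptyE) simp_all
    show "\<forall>v\<in>{a<..<b}. \<forall>y\<in>fibre u. y \<noteq> F u \<longrightarrow> s * y < s * F v \<longleftrightarrow> s * y < s * F u"
    proof (intro ballI impI)
      fix v y assume v: "v \<in> {a<..<b}" and y: "y \<in> fibre u" "y \<noteq> F u"
      have Fv: "l \<le> F v" "F v \<le> r" using F_in[of v] v by auto
      show "s * y < s * F v \<longleftrightarrow> s * y < s * F u"
        using sides[OF u y] Fu Fv s r(2) by auto
    qed
  qed
  then have count: "\<forall>s\<in>{1,-1}. \<forall>u\<in>{a<..<b}. card {y\<in>fibre u. s * y < s * F u} = m - 1 \<and>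
       (\<forall>v\<in>{a<..<b}. \<forall>y\<in>fibre u. y \<noteq> F u \<longrightarrow> s * y < s * F v \<longleftrightarrow> s * y < s * F u)"
    by blast
  have "F ` {a..b} \<subseteq> {a..b}"
  proof (rule image_subsetI)
    fix u assume "u \<in> {a..b}"
    then show "F u \<in> {a..b}" using F_in[of u] lr by simp
  qed
  then have "middle_branch F (m - 1) t"
    unfolding middle_branch_def by (intro conjI contF t count ballI hF)
  then show ?thesis by blast
qed

end

text \<open>The fibre of the composition is the union of the fibres of \<open>g\<close> over all
  \<open>x\<close> with \<open>f x = w\<close>. Each contributes \<open>l\<close> points apart from
  \<open>G x\<close>, and by monotonicity of \<open>G\<close> exactly \<open>k\<close> of the points
  \<open>G x\<close> count as well. The result is independent of \<open>s\<close>, so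
  \<open>G (F w)\<close> is a median.\<close>

lemma middle_branch_comp_count:
  assumes "full_map f a b" "full_map g a b"
    and F: "full_map.middle_branch f a b F k t" and G: "full_map.middle_branch g a b G l r"
    and w: "w \<in> {a<..<b}" and s: "s \<in> {1,-1}"
  shows "card {y\<in>{y\<in>{a..b}. f (g y) = w}. s * y < s * G (F w)} = card {x\<in>{a..b}. f x = w} * l + k"
proof -
  interpret f: full_map f a b by fact
  interpret g: full_map g a b by fact
  note F = F[unfolded f.middle_branch_def] and G = G[unfolded g.middle_branch_def]
  define q where "q = G (F w)"
  have wI: "w \<in> {a..b}" using w by auto
  have fib: "x \<in> {a<..<b}" if "x \<in> f.fibre w" for x
  proof -
    have "x \<noteq> a" "x \<noteq> b" using that f.ends w by (auto simp: f.fibre_def)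
    then show ?thesis using that by (auto simp: f.fibre_def)
  qed
  have Fw: "F w \<in> f.fibre w" using F wI unfolding f.fibre_def by blast
  then have FwI: "F w \<in> {a<..<b}" by (rule fib)
  have rG: "r \<in> {1,-1}" using G by blast
  have mono: "s * G x < s * q \<longleftrightarrow> s * r * x < s * r * F w" if "x \<in> {a<..<b}" for x
  proof -
    have Gm: "r * G x < r * G y" if "x \<in> {a..b}" "y \<in> {a..b}" "x < y" for x y
      using G that by blast
    have xI: "x \<in> {a..b}" and FI: "F w \<in> {a..b}" using that FwI by auto
    show ?thesis
      using Gm[OF xI FI] Gm[OF FI xI] s rG unfolding q_def
      by (cases x "F w" rule: linorder_cases) auto
  qed
  have each: "card {y\<in>g.fibre x. s * y < s * q} = l + (if s * G x < s * q then 1 else 0)"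
    if x: "x \<in> f.fibre w" for x
  proof -
    have xI: "x \<in> {a<..<b}" by (rule fib[OF x])
    have c: "card {y\<in>g.fibre x. s * y < s * G x} = l"
      and same: "\<And>y. y \<in> g.fibre x \<Longrightarrow> y \<noteq> G x \<Longrightarrow> s * y < s * q \<longleftrightarrow> s * y < s * G x"
      using G s xI FwI unfolding q_def by blast+
    have "x \<in> {a..b}" using xI by simp
    then have Gx: "G x \<in> g.fibre x" using G unfolding g.fibre_def by blast
    have "{y\<in>g.fibre x. s * y < s * q} =
      {y\<in>g.fibre x. s * y < s * G x} \<union> (if s * G x < s * q then {G x} else {})"
      using same Gx by auto
    then show ?thesis using c g.finite_fibre[of x] by (simp add: card_insert_if)
  qed
  have "{y\<in>{y\<in>{a..b}. f (g y) = w}. s * y < s * q} = (\<Union>x\<in>f.fibre w. {y\<in>g.fibre x. s * y < s * q})"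
    using g.h_in by (auto simp: f.fibre_def g.fibre_def simp del: atLeastAtMost_iff)
  moreover have "card \<dots> = (\<Sum>x\<in>f.fibre w. card {y\<in>g.fibre x. s * y < s * q})"
  proof (rule card_UN_disjoint)
    show "finite (f.fibre w)" by (rule f.finite_fibre)
    show "\<forall>x\<in>f.fibre w. finite {y\<in>g.fibre x. s * y < s * q}" using g.finite_fibre by simp
  qed (auto simp: g.fibre_def)
  ultimately have "card {y\<in>{y\<in>{a..b}. f (g y) = w}. s * y < s * q} =
      (\<Sum>x\<in>f.fibre w. card {y\<in>g.fibre x. s * y < s * q})" by simp
  also have "\<dots> = (\<Sum>x\<in>f.fibre w. l + (if s * G x < s * q then 1 else 0))"
    using each by (intro sum.cong) auto
  also have "\<dots> = card (f.fibre w) * l + card {x\<in>f.fibre w. s * G x < s * q}"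
    using f.finite_fibre[of w] by (simp add: sum.distrib sum.If_cases Int_def)
  also have "{x\<in>f.fibre w. s * G x < s * q} = {x\<in>f.fibre w. s * r * x < s * r * F w}"
    using mono fib by blast
  also have "card \<dots> = k"
    using F w s rG by (auto simp: f.fibre_def)
  finally show ?thesis by (simp add: q_def f.fibre_def)
qed

text \<open>Both compositions pick the median of the same fibre of \<open>f \<circ> g = g \<circ> f\<close>.\<close>

lemma middle_branches_commute:
  assumes "full_map f a b" "full_map g a b" and comm: "\<And>x. x \<in> {a..b} \<Longrightarrow> f (g x) = g (f x)"
    and F: "full_map.middle_branch f a b F k t" and G: "full_map.middle_branch g a b G l r"
    and w: "w \<in> {a..b}"
  shows "F (G w) = G (F w)"
proof -
  interpret f: full_map f a b by fact
  interpret g: full_map g a b by fact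
  have F': "continuous_on {a..b} F" "F ` {a..b} \<subseteq> {a..b}" "\<And>u. u \<in> {a..b} \<Longrightarrow> f (F u) = u"
    using F unfolding f.middle_branch_def by blast+
  have G': "continuous_on {a..b} G" "G ` {a..b} \<subseteq> {a..b}" "\<And>u. u \<in> {a..b} \<Longrightarrow> g (G u) = u"
    using G unfolding g.middle_branch_def by blast+
  have "F (G u) = G (F u)" if u: "u \<in> {a<..<b}" for u
  proof (rule median_unique)
    let ?T = "{y\<in>{a..b}. f (g y) = u}"
    have uI: "u \<in> {a..b}" using u by auto
    have T: "?T = {y\<in>{a..b}. g (f y) = u}" using comm by auto
    have "?T = (\<Union>x\<in>f.fibre u. g.fibre x)" using g.h_in by (auto simp: f.fibre_def g.fibre_def simp del: atLeastAtMost_iff)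
    then show "finite ?T" using f.finite_fibre g.finite_fibre by auto
    show "F (G u) \<in> ?T" using F' G' uI by (subst T) (auto simp: image_subset_iff)
    show "G (F u) \<in> ?T" using F' G' uI by (auto simp: image_subset_iff)
    show "card {z\<in>?T. z < F (G u)} = card {z\<in>?T. F (G u) < z}"
      using middle_branch_comp_count[OF assms(2,1) G F u, of 1]
        middle_branch_comp_count[OF assms(2,1) G F u, of "-1"] T by simp
    show "card {z\<in>?T. z < G (F u)} = card {z\<in>?T. G (F u) < z}"
      using middle_branch_comp_count[OF assms(1,2) F G u, of 1]
        middle_branch_comp_count[OF assms(1,2) F G u, of "-1"] by simp
  qed
  \<comment> \<open>The counts concern interior values only; the two ends are reached by
    continuity.\<close>
  then have "{a<..<b} \<subseteq> {x\<in>{a..b}. F (G x) = G (F x)}" by auto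
  moreover have "closed {x\<in>{a..b}. F (G x) = G (F x)}"
    by (intro compact_imp_closed compact_Collect_eq continuous_on_compose2[OF F'(1) G'(1)]
        continuous_on_compose2[OF G'(1) F'(1)] F' G' compact_Icc)
  ultimately have "closure {a<..<b} \<subseteq> {x\<in>{a..b}. F (G x) = G (F x)}" by (rule closure_minimal)
  then show ?thesis using w f.ab by auto
qed

text \<open>If one of the maps takes the same value at both ends, that value is a common fixed
  point, because both maps preserve \<open>{a,b}\<close>. Otherwise the middle inverse branches
  commute, and a common fixed point of these is one of \<open>f\<close> and
  \<open>g\<close>.\<close>

lemma full_maps_common_fixed_point:
  assumes "full_map f a b" "full_map g a b" and comm: "\<And>x. x \<in> {a..b} \<Longrightarrow> f (g x) = g (f x)"
  shows "\<exists>x\<in>{a..b}. f x = x \<and> g x = x"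
proof -
  interpret f: full_map f a b by fact
  interpret g: full_map g a b by fact
  consider "f a = f b" | "g a = g b" | "f a \<noteq> f b" "g a \<noteq> g b" by blast
  then show ?thesis
  proof cases
    case 1
    have "f (f a) = f a" "f (g (f a)) = f a" using 1 f.ends g.ends by auto
    moreover have "g (f a) = f (g (f a))" using comm[of "f a"] f.ends(1) f.ab calculation by auto
    ultimately show ?thesis using f.ends(1) f.ab by (intro bexI[of _ "f a"]) auto
  next
    case 2
    have "g (g a) = g a" "g (f (g a)) = g a" using 2 f.ends g.ends by auto
    moreover have "f (g a) = g (f (g a))" using comm[of "g a"] g.ends(1) f.ab calculation by auto
    ultimately show ?thesis using g.ends(1) f.ab by (intro bexI[of _ "g a"]) auto
  next
    case 3
    obtain F k t where F: "f.middle_branch F k t" using f.ex_middle_branch[OF 3(1)] by blast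
    obtain G l r where G: "g.middle_branch G l r" using g.ex_middle_branch[OF 3(2)] by blast
    have FG: "F (G w) = G (F w)" if "w \<in> {a..b}" for w
      by (rule middle_branches_commute[OF assms(1,2) comm F G that])
    have F': "continuous_on {a..b} F" "F ` {a..b} \<subseteq> {a..b}" "\<And>u. u \<in> {a..b} \<Longrightarrow> f (F u) = u"
      "t \<in> {1,-1}" "\<And>x y. x \<in> {a..b} \<Longrightarrow> y \<in> {a..b} \<Longrightarrow> x < y \<Longrightarrow> t * F x < t * F y"
      using F unfolding f.middle_branch_def by blast+
    have G': "continuous_on {a..b} G" "G ` {a..b} \<subseteq> {a..b}" "\<And>u. u \<in> {a..b} \<Longrightarrow> g (G u) = u"
      using G unfolding g.middle_branch_def by blast+
    have "a \<in> {a..b}" "b \<in> {a..b}" using f.ab by auto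
    then have ends_F: "a \<le> F a" "F b \<le> b" "a \<le> G a" "G b \<le> b"
      using F'(2) G'(2) by (meson atLeastAtMost_iff image_subset_iff)+
    have "\<exists>q\<in>{a..b}. F q = q \<and> G q = q"
    proof (cases "t = 1")
      case True
      let ?A = "{x\<in>{a..b}. G x = x}"
      have "compact ?A" by (intro compact_Collect_eq G' continuous_intros compact_Icc)
      moreover have "?A \<noteq> {}"
        by (rule interval_self_map_fixed_point[of a b G]) (use ends_F G'(1) f.ab in auto)
      moreover have "continuous_on ?A F" by (rule continuous_on_subset[OF F'(1)]) auto
      moreover have "F ` ?A \<subseteq> ?A"
      proof (rule image_subsetI)
        fix x assume "x \<in> ?A"
        then have "x \<in> {a..b}" "G x = x" by blast+
        moreover from this have "F x \<in> {a..b}" "G (F x) = F x" using FG[of x] F'(2) by (blast, simp)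
        ultimately show "F x \<in> ?A" by blast
      qed
      moreover have "mono_on ?A F"
      proof (rule mono_onI)
        fix x y assume "x \<in> ?A" "y \<in> ?A" "x \<le> y"
        then show "F x \<le> F y" using F'(5)[of x y] True by (cases "x = y") auto
      qed
      ultimately obtain q where "q \<in> ?A" "F q = q" by (rule mono_on_compact_fixed_point)
      then show ?thesis by blast
    next
      case False
      then have t: "t = -1" using F'(4) by auto
      obtain q where q: "q \<in> {a..b}" "F q = q"
        by (rule interval_self_map_fixed_point[of a b F]) (use ends_F F'(1) f.ab in auto)
      \<comment> \<open>\<open>F\<close> is strictly decreasing and so has at most one fixed point,
        while \<open>G q\<close> is fixed by \<open>F\<close> as well.\<close>
      have Gq: "G q \<in> {a..b}" "F (G q) = G q" using FG[OF q(1)] q G'(2) by (blast, simp)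
      have "G q = q"
        using F'(5)[OF q(1) Gq(1)] F'(5)[OF Gq(1) q(1)] unfolding q(2) Gq(2) t by linarith
      then show ?thesis using q by blast
    qed
    then show ?thesis using F'(3) G'(3) by metis
  qed
qed

subsection \<open>The common fixed point\<close>

context strongly_commuting
begin

lemma turning_valueI: "s \<in> {1,-1} \<Longrightarrow> loc_ext s f c \<Longrightarrow> f c \<in> {0<..<1} \<Longrightarrow> f c \<in> turning_values f"
  by (auto simp: turning_values_def ext_values_def)

lemma full_map_restrict:
  assumes "0 \<le> p" "p < q" "q \<le> 1" "f ` {p..q} \<subseteq> {p..q}" "f p \<in> {p,q}" "f q \<in> {p,q}"
    and no: "turning_values f \<inter> {p<..<q} = {}"
  shows "full_map f p q"
proof
  have sub: "{p..q} \<subseteq> {0..1}" using assms by auto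
  show "continuous_on {p..q} f" by (rule continuous_on_subset[OF cont_f sub])
  show "finite {x\<in>{p..q}. f x = u}" for u
    by (rule finite_subset[OF _ fin_f[of u]]) (use sub in auto)
  fix s x c y
  assume *: "s \<in> {1,-1::real}" "p \<le> x" "x < c" "c < y" "y \<le> q"
    "\<And>z. z \<in> {x..y} \<Longrightarrow> s * f z \<le> s * f c"
  have "loc_ext s f c" by (rule loc_extI[of c x y]) (use * assms in auto)
  moreover have "f c \<in> {p..q}" using assms(4) * by (meson atLeastAtMost_iff image_subset_iff less_imp_le order_trans)
  ultimately show "f c \<in> {p,q}" using turning_valueI[OF *(1)] no assms(1,3) by force
qed fact+

text \<open>Uniqueness of the preimage spreads from \<open>v\<close> over \<open>K\<close>: by
  \<open>two_preimages_spread\<close>, two preimages of any point of \<open>K\<close> would produce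
  two of \<open>v\<close>.\<close>

lemma single_preimage_interval:
  assumes K: "is_interval K" "K \<subseteq> {0<..<1}" "K \<inter> turning_values f = {}"
    and v: "v \<in> K" "\<And>x y. x \<in> {0..1} \<Longrightarrow> y \<in> {0..1} \<Longrightarrow> f x = v \<Longrightarrow> f y = v \<Longrightarrow> x = y"
    and xy: "x \<in> {0..1}" "y \<in> {0..1}" "f x = f y" "f x \<in> K"
  shows "x = y"
proof (rule ccontr)
  have ext: "f c \<notin> K" if "s \<in> {1,-1}" "loc_ext s f c" for c s
    using turning_valueI[OF that] K by blast
  have no: False if xy: "x \<in> {0..1}" "y \<in> {0..1}" "f x = f y" "f x \<in> K" "x < y" for x y
  proof -
    have "\<exists>a\<in>{0..1}. \<exists>b\<in>{0..1}. a < b \<and> f a = v \<and> f b = v"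
      by (rule two_preimages_spread[OF cont_f fin_f K(1) _ xy(1,2,5) refl xy(3)[symmetric] xy(4) v(1)])
        (rule ext)
    then obtain a b where "a \<in> {0..1}" "b \<in> {0..1}" "a < b" "f a = v" "f b = v" by blast
    then show False using v(2)[of a b] by simp
  qed
  assume "x \<noteq> y"
  then show False using no[of x y] no[of y x] xy by (metis linorder_neqE)
qed

lemma turning_values_unit: "turning_values g \<subseteq> {0<..<1}"
  by (auto simp: turning_values_def)

text \<open>An end point is never a crossing, so it is an extremum, and an interior value there
  would be a turning value.\<close>

lemma end_values:
  assumes "turning_values f = {}" "x \<in> {0,1}"
  shows "f x \<in> {0,1}"
proof (rule ccontr)
  assume "f x \<notin> {0,1}"
  have xI: "x \<in> {0..1}" using assms by auto
  then have fx: "f x \<in> {0<..<1}" using f_in[of x] \<open>f x \<notin> {0,1}\<close> by auto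
  show False
  proof (rule loc_ext_or_crosses[OF cont_f fin_f xI])
    show False if "s \<in> {1,-1}" "loc_ext s f x" for s using turning_valueI[OF that fx] assms(1) by blast
    show False if "crosses s f x" for s using that assms(2) by (auto simp: crosses_def)
  qed
qed

text \<open>A turning value of \<open>g\<close> has a single preimage under \<open>f\<close>, and in
  the absence of turning values of \<open>f\<close> this spreads over the open unit interval. So
  \<open>f\<close> is injective, and the single-preimage argument applies with the roles
  exchanged.\<close>

lemma common_fixed_point_one_sided:
  assumes "turning_values g \<noteq> {}" "turning_values f = {}"
  shows "\<exists>x\<in>{0..1}. f x = x \<and> g x = x"
proof -
  interpret sw: strongly_commuting g f by (rule swap)
  obtain v where v: "v \<in> turning_values g" using assms by blast
  have inner: "x = y" if "x \<in> {0..1}" "y \<in> {0..1}" "f x = f y" "f x \<in> {0<..<1}" for x y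
  proof (rule single_preimage_interval[of "{0<..<1}" v])
    show "v \<in> {0<..<1}" using v turning_values_unit by blast
    show "x = y" if "x \<in> {0..1}" "y \<in> {0..1}" "f x = v" "f y = v" for x y
      using single_preimage_turning[OF v _ that] assms by blast
  qed (use that assms in \<open>auto simp: is_interval_oo\<close>)
  \<comment> \<open>The common value might still be 0 or 1. A level halfway to another value
    \<open>f m\<close> is interior, and it is taken on both sides of \<open>m\<close>.\<close>
  have no: False if xy: "x \<in> {0..1}" "y \<in> {0..1}" "f x = f y" "x < y" for x y
  proof -
    have "\<not> {x<..<y} \<subseteq> {z\<in>{0..1}. f z = f x}"
      using finite_subset[OF _ fin_f[of "f x"]] infinite_Ioo[OF xy(4)] by blast
    then obtain m where m: "x < m" "m < y" "f m \<noteq> f x" using xy(1,2) by fastforce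
    define u where "u = (f x + f m) / 2"
    have mI: "m \<in> {0..1}" using m xy by auto
    have c: "continuous_on {x..m} f" "continuous_on {m..y} f"
      using xy m by (auto intro!: continuous_on_subset[OF cont_f])
    have btw: "f x \<le> u \<and> u \<le> f m \<or> f m \<le> u \<and> u \<le> f x" unfolding u_def by auto
    obtain z where z: "z \<in> {x..m}" "f z = u" using ivt_between[OF _ c(1) btw] m by auto
    obtain z' where z': "z' \<in> {m..y}" "f z' = u" using ivt_between[OF _ c(2), of u] btw m xy(3) by auto
    have "f x \<in> {0..1}" "f m \<in> {0..1}" using f_in xy(1) mI by blast+
    then have "u \<in> {0<..<1}" using m(3) unfolding u_def by auto
    then have "z = z'" using inner[of z z'] z z' xy m by auto
    then have "u = f m" using z z' by auto
    then show False using m(3) by (simp add: u_def)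
  qed
  have inj: "x = y" if "x \<in> {0..1}" "y \<in> {0..1}" "f x = f y" for x y
    using no[of x y] no[of y x] that by (metis linorder_neqE)
  have "\<exists>x\<in>{0..1}. g x = x \<and> f x = x"
    by (rule sw.common_fixed_point_single_preimage) (rule inj)
  then show ?thesis by blast
qed

lemma common_fixed_point_reversing:
  assumes ne: "turning_values g \<noteq> {}"
    and rev1: "\<And>v x. v \<in> turning_values g \<Longrightarrow> x \<in> {0..1} \<Longrightarrow> x < v \<Longrightarrow> f v \<le> f x"
    and rev2: "\<And>v x. v \<in> turning_values g \<Longrightarrow> x \<in> {0..1} \<Longrightarrow> v < x \<Longrightarrow> f x \<le> f v"
  shows "\<exists>x\<in>{0..1}. f x = x \<and> g x = x"
proof -
  interpret sw: strongly_commuting g f by (rule swap)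
  let ?V = "turning_values g" and ?W = "turning_values f"
  have VI: "v \<in> {0..1}" "v \<in> {0<..<1}" if "v \<in> ?V" for v using that turning_values_unit by auto
  have fV: "f v \<in> ?V" if "v \<in> ?V" for v using that turning_values_permuted(1) by blast
  have f01: "0 \<le> f 0" "f 1 \<le> 1" using f_in[of 0] f_in[of 1] by auto
  obtain p where p: "p \<in> {0..1}" "f p = p"
    by (rule interval_self_map_fixed_point[OF _ cont_f f01]) simp
  have fix_g: "g x \<in> {0..1}" "f (g x) = g x" if "x \<in> {0..1}" "f x = x" for x
    using that g_in[of x] comm[of x] by auto
  \<comment> \<open>\<open>g\<close> maps fixed points of \<open>f\<close> to fixed points of
    \<open>f\<close>, so a unique one is fixed by \<open>g\<close>.\<close>
  have unique_fix: ?thesis if "\<And>x. x \<in> {0..1} \<Longrightarrow> f x = x \<Longrightarrow> x = p"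
    using that[OF fix_g[OF p]] p by blast
  show ?thesis
  proof (cases "p \<in> ?V")
    case True
    show ?thesis
    proof (rule unique_fix)
      fix x assume "x \<in> {0..1}" "f x = x"
      then show "x = p" using rev1[OF True, of x] rev2[OF True, of x] p(2)
        by (cases x p rule: linorder_cases) auto
    qed
  next
    case False
    \<comment> \<open>\<open>f\<close> exchanges the turning values on the two sides of
      \<open>p\<close>, and therefore swaps the ends \<open>a\<close> and \<open>b\<close> of the
      gap around \<open>p\<close>.\<close>
    define L where "L = {v\<in>?V. v < p}"
    define R where "R = {v\<in>?V. p < v}"
    have "v < p \<or> p < v" if "v \<in> ?V" for v using False that by (metis linorder_neqE)
    then have LR: "L \<union> R = ?V" by (auto simp: L_def R_def)
    have fL: "f v \<in> R" if "v \<in> L" for v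
      using rev2[of v p] that p fV[of v] False by (auto simp: L_def R_def order.order_iff_strict)
    have fR: "f v \<in> L" if "v \<in> R" for v
      using rev1[of v p] that p fV[of v] False by (auto simp: L_def R_def order.order_iff_strict)
    have fin: "finite L" "finite R" using fin_tg by (auto simp: L_def R_def)
    have neLR: "L \<noteq> {}" "R \<noteq> {}" using ne LR fL fR by blast+
    define a where "a = Max L"
    define b where "b = Min R"
    have aL: "a \<in> L" "\<And>v. v \<in> L \<Longrightarrow> v \<le> a" using fin neLR by (auto simp: a_def)
    have bR: "b \<in> R" "\<And>v. v \<in> R \<Longrightarrow> b \<le> v" using fin neLR by (auto simp: b_def)
    have apb: "a < p" "p < b" and aV: "a \<in> ?V" and bV: "b \<in> ?V" using aL(1) bR(1) by (auto simp: L_def R_def)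
    have abI: "a \<in> {0..1}" "b \<in> {0..1}" "0 < a" "b < 1" using VI aV bV by auto
    have gapV: "?V \<inter> {a<..<b} = {}" using LR aL bR by force
    have fa: "f a = b"
    proof (rule antisym)
      show "b \<le> f a" using bR(2) fL aL(1) by blast
      obtain v where v: "v \<in> ?V" "f v = b" using turning_values_permuted(1) bV by (metis imageE)
      have "v \<notin> R" using fR[of v] v bR(1) by (auto simp: L_def R_def)
      then have "v \<in> L" using v LR by blast
      then show "f a \<le> b" using aL(2)[of v] rev1[OF aV VI(1)[OF v(1)]] v(2) by (cases "v = a") auto
    qed
    have fb: "f b = a"
    proof (rule antisym)
      show "f b \<le> a" using aL(2) fR bR(1) by blast
      obtain v where v: "v \<in> ?V" "f v = a" using turning_values_permuted(1) aV by (metis imageE)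
      have "v \<notin> L" using fL[of v] v aL(1) by (auto simp: L_def R_def)
      then have "v \<in> R" using v LR by blast
      then show "a \<le> f b" using bR(2)[of v] rev2[OF bV VI(1)[OF v(1)]] v(2) by (cases "v = b") auto
    qed
    have fix_in: "x \<in> {a<..<b}" if x: "x \<in> {0..1}" "f x = x" for x
    proof -
      have "\<not> x < a" using rev1[OF aV x(1)] x(2) fa apb by auto
      moreover have "\<not> b < x" using rev2[OF bV x(1)] x(2) fb apb by auto
      moreover have "x \<noteq> a" "x \<noteq> b" using x(2) fa fb apb by auto
      ultimately show ?thesis by auto
    qed
    have f_self: "f ` {a..b} \<subseteq> {a..b}"
    proof (rule image_subsetI)
      fix x assume x: "x \<in> {a..b}"
      then have xI: "x \<in> {0..1}" using abI by auto
      have "f x \<le> b" using rev2[OF aV xI] fa x apb by (cases "x = a") auto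
      moreover have "a \<le> f x" using rev1[OF bV xI] fb x apb by (cases "x = b") auto
      ultimately show "f x \<in> {a..b}" by simp
    qed
    have K01: "K \<subseteq> {0<..<1}" if "K \<subseteq> {a..b}" for K using that abI by force
    show ?thesis
    proof (cases "?W \<inter> {a<..<b} = {}")
      case False
      then obtain w where w: "w \<in> ?W" "w \<in> {a<..<b}" by blast
      then have "w \<notin> ?V" using gapV by blast
      \<comment> \<open>\<open>w\<close> is a turning value of \<open>f\<close> but not of
        \<open>g\<close>, so \<open>g\<close> has a single inverse branch over the gap, where all
        fixed points of \<open>f\<close> lie.\<close>
      have single: "x = y" if "x \<in> {0..1}" "y \<in> {0..1}" "g x = g y" "g x \<in> {a<..<b}" for x y
      proof (rule sw.single_preimage_interval[of "{a<..<b}" w])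
        show "{a<..<b} \<subseteq> {0<..<1}" by (rule K01) auto
        show "x = y" if "x \<in> {0..1}" "y \<in> {0..1}" "g x = w" "g y = w" for x y
          by (rule sw.single_preimage_turning[OF w(1) \<open>w \<notin> ?V\<close> that])
      qed (use that w gapV in \<open>auto simp: is_interval_oo\<close>)
      show ?thesis
      proof (rule common_fixed_point_single_preimage)
        fix q r x y
        assume *: "q \<in> {0..1}" "r \<in> {0..1}" "f q = q" "f r = r" "x \<in> {0..1}" "y \<in> {0..1}"
          "q \<le> g x" "g x \<le> r" "g x = g y"
        have "g x \<in> {a<..<b}" using fix_in[OF *(1,3)] fix_in[OF *(2,4)] *(7,8) by auto
        then show "x = y" by (rule single[OF *(5,6,9)])
      qed
    next
      case gapW: True
      show ?thesis
      proof (cases "a \<in> ?W \<and> b \<in> ?W")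
        case False
        \<comment> \<open>\<open>K\<close> is the gap together with an end \<open>v\<close> that is
          no turning value of \<open>f\<close>; at this \<open>v\<close> the preimage under
          \<open>f\<close> is known to be unique.\<close>
        then obtain K v where K: "is_interval K" "{a<..<b} \<subseteq> K" "K \<subseteq> {a..b}" "K \<inter> ?W = {}"
          and v: "v \<in> K" "v \<in> ?V" "v \<notin> ?W"
        proof (cases "a \<in> ?W")
          case True
          then show ?thesis using False gapW bV apb
            by (intro that[of "{a<..b}" b]) (auto simp: is_interval_oc order.order_iff_strict)
        next
          case False
          then show ?thesis using gapW aV apb
            by (intro that[of "{a..<b}" a]) (auto simp: is_interval_co order.order_iff_strict)
        qed
        have single: "x = y" if "x \<in> {0..1}" "y \<in> {0..1}" "f x = f y" "f x \<in> K" for x y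
          using single_preimage_interval[OF K(1) K01[OF K(3)] K(4) v(1) _ that]
            single_preimage_turning[OF v(2,3)] by blast
        \<comment> \<open>On \<open>{a..x}\<close> the map \<open>f\<close> goes from the value
          \<open>b\<close> to the value \<open>x\<close>, so it takes the value \<open>y\<close>
          there, although \<open>y\<close> is the only preimage of itself.\<close>
        have less: False if x: "x \<in> {0..1}" "f x = x" and y: "y \<in> {0..1}" "f y = y" and "x < y" for x y
        proof -
          have xy: "x \<in> {a<..<b}" "y \<in> {a<..<b}" using fix_in x y by auto
          have "\<exists>z\<in>{a..x}. f z = y"
            using xy x fa \<open>x < y\<close> abI by (intro ivt_between continuous_on_subset[OF cont_f]) auto
          then obtain z where z: "z \<in> {a..x}" "f z = y" by blast
          then have "z = y" using single[of z y] y xy K(2) x abI by auto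
          then show False using z \<open>x < y\<close> by auto
        qed
        show ?thesis
        proof (rule unique_fix)
          fix x assume "x \<in> {0..1}" "f x = x"
          then show "x = p" using less[of x p] less[of p x] p by (metis linorder_neqE)
        qed
      next
        case True
        then have aW: "a \<in> ?W" and bW: "b \<in> ?W" by auto
        \<comment> \<open>Both ends are now turning values of both maps. So \<open>g\<close> also
          fixes or exchanges them and preserves the gap, which makes \<open>f\<close> and
          \<open>g\<close> full maps of \<open>{a..b}\<close>.\<close>
        have ends: "g a \<in> {a,b} \<and> g b \<in> {a,b} \<and> (\<forall>x\<in>{a<..<b}. g x \<in> {a..b})"
        proof (rule sw.turning_values_structure)
          assume "\<And>v. v \<in> ?W \<Longrightarrow> g v = v"
            "\<And>v x. v \<in> ?W \<Longrightarrow> x \<in> {0..1} \<Longrightarrow> x < v \<Longrightarrow> g x \<le> v"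
            "\<And>v x. v \<in> ?W \<Longrightarrow> x \<in> {0..1} \<Longrightarrow> v < x \<Longrightarrow> v \<le> g x"
          then show ?thesis using aW bW abI by auto
        next
          assume r1: "\<And>v x. v \<in> ?W \<Longrightarrow> x \<in> {0..1} \<Longrightarrow> x < v \<Longrightarrow> g v \<le> g x"
            and r2: "\<And>v x. v \<in> ?W \<Longrightarrow> x \<in> {0..1} \<Longrightarrow> v < x \<Longrightarrow> g x \<le> g v"
          have WI: "w \<in> {0..1}" if "w \<in> ?W" for w using that sw.turning_values_unit by auto
          have gW: "g w \<in> ?W" if "w \<in> ?W" for w using that sw.turning_values_permuted(1) by blast
          have gapW': "w \<le> a \<or> b \<le> w" if "w \<in> ?W" for w using gapW that by force
          \<comment> \<open>As a fixed point of \<open>f\<close>, the point \<open>g p\<close> stays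
            in the gap; this decides on which side of the gap \<open>g a\<close> and
            \<open>g b\<close> lie.\<close>
          have gp: "g p \<in> {a<..<b}" by (rule fix_in[OF fix_g[OF p]])
          have "g p \<le> g a" "g b \<le> g p" using r2[OF aW p(1)] r1[OF bW p(1)] apb by auto
          then have gab: "b \<le> g a" "g b \<le> a" using gapW'[OF gW[OF aW]] gapW'[OF gW[OF bW]] gp by auto
          have "g a \<le> b"
          proof -
            obtain w where w: "w \<in> ?W" "g w = b" using sw.turning_values_permuted(1) bW by (metis imageE)
            have "\<not> b < w" using r2[OF bW WI[OF w(1)]] w gab apb by auto
            moreover have "w \<noteq> b" using w gab apb by auto
            ultimately have "w \<le> a" using gapW'[OF w(1)] by auto
            then show ?thesis using r1[OF aW WI[OF w(1)]] w by (cases "w = a") auto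
          qed
          moreover have "a \<le> g b"
          proof -
            obtain w where w: "w \<in> ?W" "g w = a" using sw.turning_values_permuted(1) aW by (metis imageE)
            have "\<not> w < a" using r1[OF aW WI[OF w(1)]] w gab apb by auto
            moreover have "w \<noteq> a" using w gab apb by auto
            ultimately have "b \<le> w" using gapW'[OF w(1)] by auto
            then show ?thesis using r2[OF bW WI[OF w(1)]] w by (cases "w = b") auto
          qed
          ultimately have gab': "g a = b" "g b = a" using gab by auto
          moreover have "g x \<in> {a..b}" if x: "x \<in> {a<..<b}" for x
          proof -
            have "x \<in> {0..1}" using x abI by auto
            then show ?thesis using r2[OF aW, of x] r1[OF bW, of x] x gab' by auto
          qed
          ultimately show ?thesis by auto
        qed
        have g_self: "g ` {a..b} \<subseteq> {a..b}"
        proof (rule image_subsetI)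
          fix x assume "x \<in> {a..b}"
          then consider "x = a" | "x = b" | "x \<in> {a<..<b}" by force
          then show "g x \<in> {a..b}" using ends apb by cases auto
        qed
        have "full_map f a b"
          using abI apb fa fb gapW by (intro full_map_restrict f_self) auto
        moreover have "full_map g a b"
          using abI apb ends gapV by (intro sw.full_map_restrict g_self) auto
        ultimately have "\<exists>x\<in>{a..b}. f x = x \<and> g x = x"
          using comm abI by (intro full_maps_common_fixed_point) auto
        then show ?thesis using abI by auto
      qed
    qed
  qed
qed

text \<open>Replace \<open>v\<close> by the last turning value \<open>a\<close> of \<open>g\<close>
  below \<open>w\<close>. Then \<open>{a<..w}\<close> contains no turning value of \<open>g\<close>,
  and \<open>w\<close> has one preimage under \<open>g\<close>, so \<open>g\<close> has a single
  inverse branch there. Under \<open>f\<close> the point \<open>a\<close> is its own only preimage,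
  so \<open>f\<close> keeps points strictly to the right of \<open>a\<close>.\<close>

lemma common_fixed_point_fixing:
  assumes vw: "v \<in> turning_values g" "w \<in> turning_values f" "v < w"
    and disj: "turning_values g \<inter> turning_values f = {}"
    and fix_f: "\<And>v. v \<in> turning_values g \<Longrightarrow> f v = v"
    and f_right: "\<And>v x. v \<in> turning_values g \<Longrightarrow> x \<in> {0..1} \<Longrightarrow> v < x \<Longrightarrow> v \<le> f x"
    and fix_g: "\<And>v. v \<in> turning_values f \<Longrightarrow> g v = v"
    and g_left: "\<And>v x. v \<in> turning_values f \<Longrightarrow> x \<in> {0..1} \<Longrightarrow> x < v \<Longrightarrow> g x \<le> v"
  shows "\<exists>x\<in>{0..1}. f x = x \<and> g x = x"
proof -
  interpret sw: strongly_commuting g f by (rule swap)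
  let ?V = "turning_values g" and ?W = "turning_values f"
  define L where "L = {v\<in>?V. v < w}"
  define a where "a = Max L"
  have L: "finite L" "L \<noteq> {}" using fin_tg vw by (auto simp: L_def)
  have "a \<in> L" and a_max: "\<And>v. v \<in> L \<Longrightarrow> v \<le> a" using L by (auto simp: a_def)
  then have a: "a \<in> ?V" "a < w" "a \<notin> ?W" using disj by (auto simp: L_def)
  have "w \<notin> ?V" using disj vw by blast
  then have gap: "{a<..w} \<inter> ?V = {}" using a_max by (force simp: L_def order.order_iff_strict)
  have unit: "0 < a" "w < 1" using a(1) vw(2) turning_values_unit sw.turning_values_unit by auto
  then have I: "a \<in> {0..1}" "w \<in> {0..1}" using a(2) by auto
  have single: "x = y" if "x \<in> {0..1}" "y \<in> {0..1}" "g x = g y" "g x \<in> {a<..w}" for x y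
  proof (rule sw.single_preimage_interval[of "{a<..w}" w])
    show "{a<..w} \<subseteq> {0<..<1}" using unit by auto
    show "x = y" if "x \<in> {0..1}" "y \<in> {0..1}" "g x = w" "g y = w" for x y
      by (rule sw.single_preimage_turning[OF vw(2) \<open>w \<notin> ?V\<close> that])
  qed (use that gap a(2) in \<open>auto simp: is_interval_oc\<close>)
  show ?thesis
  proof (rule common_fixed_point_between[OF a(2) I fix_f[OF a(1)] fix_g[OF vw(2)]])
    have "g a \<noteq> w" using single[of a w] I fix_g[OF vw(2)] a(2) by auto
    then show "g a < w" using g_left[OF vw(2) I(1) a(2)] by simp
    show "x = y" if "x \<in> {0..1}" "y \<in> {0..1}" "g x = g y" "a < g x" "g x \<le> w" for x y
      using single[OF that(1-3)] that(4,5) by simp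
    show "a < f u" if u: "u \<in> {0..1}" "a < u" for u
    proof -
      have "f u \<noteq> a" using single_preimage_turning[OF a(1,3) u(1) I(1) _ fix_f[OF a(1)]] u(2) by auto
      then show ?thesis using f_right[OF a(1) u] by simp
    qed
  qed
qed

lemma common_fixed_point: "\<exists>x\<in>{0..1}. f x = x \<and> g x = x"
proof -
  interpret sw: strongly_commuting g f by (rule swap)
  let ?V = "turning_values g" and ?W = "turning_values f"
  consider "?V = {}" "?W = {}" | "?V \<noteq> {}" "?W = {}" | "?V = {}" "?W \<noteq> {}" | "?V \<noteq> {}" "?W \<noteq> {}"
    by blast
  then show ?thesis
  proof cases
    case 1
    have "full_map f 0 1"
      by (rule full_map_restrict) (use 1 end_values onto_f in auto)
    moreover have "full_map g 0 1"
      by (rule sw.full_map_restrict) (use 1 sw.end_values onto_g in auto)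
    ultimately show ?thesis using comm by (rule full_maps_common_fixed_point)
  next
    case 2
    then show ?thesis by (rule common_fixed_point_one_sided)
  next
    case 3
    have "\<exists>x\<in>{0..1}. g x = x \<and> f x = x" by (rule sw.common_fixed_point_one_sided[OF 3(2,1)])
    then show ?thesis by blast
  next
    case 4
    show ?thesis
    proof (rule turning_values_structure)
      assume "\<And>v x. v \<in> ?V \<Longrightarrow> x \<in> {0..1} \<Longrightarrow> x < v \<Longrightarrow> f v \<le> f x"
        "\<And>v x. v \<in> ?V \<Longrightarrow> x \<in> {0..1} \<Longrightarrow> v < x \<Longrightarrow> f x \<le> f v"
      then show ?thesis by (rule common_fixed_point_reversing[OF 4(1)])
    next
      assume f: "\<And>v. v \<in> ?V \<Longrightarrow> f v = v"
        "\<And>v x. v \<in> ?V \<Longrightarrow> x \<in> {0..1} \<Longrightarrow> x < v \<Longrightarrow> f x \<le> v"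
        "\<And>v x. v \<in> ?V \<Longrightarrow> x \<in> {0..1} \<Longrightarrow> v < x \<Longrightarrow> v \<le> f x"
      show ?thesis
      proof (rule sw.turning_values_structure)
        assume "\<And>v x. v \<in> ?W \<Longrightarrow> x \<in> {0..1} \<Longrightarrow> x < v \<Longrightarrow> g v \<le> g x"
          "\<And>v x. v \<in> ?W \<Longrightarrow> x \<in> {0..1} \<Longrightarrow> v < x \<Longrightarrow> g x \<le> g v"
        then have "\<exists>x\<in>{0..1}. g x = x \<and> f x = x" by (rule sw.common_fixed_point_reversing[OF 4(2)])
        then show ?thesis by blast
      next
        assume g: "\<And>v. v \<in> ?W \<Longrightarrow> g v = v"
          "\<And>v x. v \<in> ?W \<Longrightarrow> x \<in> {0..1} \<Longrightarrow> x < v \<Longrightarrow> g x \<le> v"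
          "\<And>v x. v \<in> ?W \<Longrightarrow> x \<in> {0..1} \<Longrightarrow> v < x \<Longrightarrow> v \<le> g x"
        show ?thesis
        proof (cases "?V \<inter> ?W = {}")
          case False
          then obtain v where "v \<in> ?V" "v \<in> ?W" by blast
          then show ?thesis using f(1) g(1) turning_values_unit by (intro bexI[of _ v]) auto
        next
          case disj: True
          obtain v w where v: "v \<in> ?V" and w: "w \<in> ?W" using 4 by blast
          then have "v < w \<or> w < v" using disj by (metis disjoint_iff linorder_neqE)
          then show ?thesis
          proof
            assume "v < w"
            then show ?thesis by (rule common_fixed_point_fixing[OF v w _ disj f(1,3) g(1,2)])
          next
            assume "w < v"
            then have "\<exists>x\<in>{0..1}. g x = x \<and> f x = x"
              by (rule sw.common_fixed_point_fixing[OF w v _ _ g(1,3) f(1,2)]) (use disj in blast)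
            then show ?thesis by blast
          qed
        qed
      qed
    qed
  qed
qed

end

theorem corollary5p23:
  fixes f g :: "real \<Rightarrow> real"
  assumes "interval_map f" and "interval_map g"
    and "piecewise_monotone f" and "piecewise_monotone g"
    and "f ` unit_interval = unit_interval" and "g ` unit_interval = unit_interval"
    and "strongly_commute f g"
  shows "\<exists>x\<in>unit_interval. f x = x \<and> g x = x"
proof -
  have cont: "continuous_on {0..1} f" "continuous_on {0..1} g"
    using assms(1,2) by (auto simp: interval_map_def)
  have sc: "{f y | y. y \<in> {0..1} \<and> g y = x} = {z \<in> {0..1}. g z = f x}" if "x \<in> {0..1}" for x
    using assms(7) that by (simp add: strongly_commute_def)
  interpret strongly_commuting f g
  proof
    fix x assume x: "x \<in> {0..1::real}"
    then have "g x \<in> {0..1}" using assms(6) by blast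
    \<comment> \<open>Strong commutation is applied at \<open>g x\<close>, one of whose preimages
      under \<open>g\<close> is \<open>x\<close>.\<close>
    then have "f x \<in> {z \<in> {0..1}. g z = f (g x)}" using sc[of "g x"] x by blast
    then show "f (g x) = g (f x)" by simp
    show "\<exists>y\<in>{0..1}. g y = x \<and> f y = z" if "z \<in> {0..1}" "f x = g z" for z
    proof -
      have "z \<in> {f y | y. y \<in> {0..1} \<and> g y = x}" using sc[OF x] that by simp
      then show ?thesis by blast
    qed
  qed (rule cont assms(5,6) piecewise_monotone_finite_fibre finite_turning_values assms(3,4))+
  show ?thesis by (rule common_fixed_point)
qed

end
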